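(* Let $\tau$ be the specific element of $\mathfrak T$ described in the context. For each $s\in\mathbb Z_\wp$ there is a quantum vertex algebra homomorphism $R(s)$ from $V_{\wp,\tau}^\ell(\mathfrak g)$ to itself determined by $$R(s)\xi_{i,m}^a=\xi_{i,m+s}^a\qquad(i\in I,\ m\in\mathbb Z_\wp,\ a\in\{0,1^\pm,2^\pm\}).$$ Moreover, $(V_{\wp,\tau}^\ell(\mathfrak g),R)$ is a $\mathbb Z_\wp$-module quantum vertex algebra, i.e. $R$ is a group homomorphism from $\mathbb Z_\wp$ to the group of automorphisms of the quantum vertex algebra $V_{\wp,\tau}^\ell(\mathfrak g)$.
   Context: **Lie data.** $\mathfrak g$ is a finite-dimensional simple Lie algebra over $\mathbb C$ with Cartan matrix $(a_{ij})_{i,j\in I}$. $r=1$ (simply laced), $2$ ($B_n,C_n,F_4$), $3$ ($G_2$); $r_i=1$ if $\alpha_i$ is short (or $\mathfrak g$ simply laced), $r_i=r$ if $\alpha_i$ is long. $\wp>2r$ is an integer, $\zeta$ a primitive $\wp$-th root of unity, $\ell\in\mathbb Z$, $\mathbb Z_\wp=\mathbb Z/\wp\mathbb Z$, $q_i=q^{r_i}$, $\wp_i=\wp/\gcd(\wp,2r_i)$, $[n]_a=\frac{a^n-a^{-n}}{a-a^{-1}}$ ($n\in\mathbb Z$). For $g=\sum a_nq^n\in\mathbb Z[q,q^{-1}]$, $\langle g\rangle_\wp=\sum_n a_{n\wp}$ (so $\langle gq^s\rangle_\wp$ makes sense for $s\in\mathbb Z_\wp$). **Nonlocal vertex algebras.**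 $\mathcal E^{(k)}(W)=\mathrm{Hom}(W,W((z_1,\dots,z_k)))$, $\mathcal E(W)=\mathcal E^{(1)}(W)$. A nonlocal vertex algebra is a vector space $V$ with $\mathbf 1\in V$ and linear $Y:V\to\mathcal E(V)$, $Y(u,z)=\sum u(n)z^{-n-1}$, with $Y(\mathbf 1,z)=1$, $Y(u,z)\mathbf 1\in V[[z]]$, $\lim_{z\to0}Y(u,z)\mathbf 1=u$, such that for all $u_1,\dots,u_k$ there is $N$ with $\prod_{i<j}(z_i-z_j)^NY(u_1,z_1)\cdots Y(u_k,z_k)\in\mathcal E^{(k)}(V)$, and $Y(Y(u,z_0)v,z_2)=z_0^{-N}\big((z_1-z_2)^NY(u,z_1)Y(v,z_2)\big)|_{z_1=z_2+z_0}$ whenever $(z_1-z_2)^NY(u,z_1)Y(v,z_2)\in\mathcal E^{(2)}(V)$. $\partial u=\lim_{z\to0}\frac{d}{dz}Y(u,z)\mathbf 1$. An ideal is a subspace $J$ with $Y(u,z)v\in J((z))$ if $u\in J$ or $v\in J$. Write $Y(z)(u\otimes v)=Y(u,z)v$; superscripts indicate tensor positions. A quantum vertex algebra is a nonlocal vertex algebra with a linear $S(z):V\otimes V\to V\otimes V\otimes\mathbb C((z))$ such that $S(z)(v\otimes\mathbf 1)=v\otimes\mathbf 1$, $S(z)(\mathbf 1\otimes v)=\mathbf 1\otimes v$; $S(z_1)Y^{12}(z_2)=Y^{12}(z_2)S^{23}(z_1)S^{13}(z_1+z_2)$; $S(z_1)Y^{23}(z_2)=Y^{23}(z_2)S^{12}(z_1-z_2)S^{13}(z_1)$;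 for all $u,v$ there is $k$ with $(z_1-z_2)^kY(u,z_1)Y(v,z_2)w=(z_1-z_2)^kY^{12}(z_2)Y^{23}(z_1)S^{12}(z_2-z_1)(v\otimes u\otimes w)$ for all $w$; $S(z)S^{21}(-z)=1$; $S^{12}(z_1)S^{13}(z_1+z_2)S^{23}(z_2)=S^{23}(z_2)S^{13}(z_1+z_2)S^{12}(z_1)$. A quantum vertex algebra homomorphism is a linear map preserving $\mathbf 1$ and $Y$ and intertwining the operators $S(z)$. **Integers** ($i,j\in I$, $m,n\in\mathbb Z_\wp$): $A^{0,0}_{ijmn}=\langle[a_{ij}]_{q_i}[r\ell/r_j]_{q_j}q^{-r\ell+n-m}\rangle_\wp$, $A^{0,1}_{ijmn}=\langle[a_{ij}]_{q_i}(q^{-r\ell}-q^{r\ell})q^{-r\ell+n-m}\rangle_\wp$, $A^{1,0}_{ijmn}=\langle[a_{ji}]_{q_j}(q^{r\ell}-q^{-r\ell})q^{-r\ell+n-m}\rangle_\wp$, $A^{0,2}_{ijmn}=\langle[a_{ij}]_{q_i}q^{-r\ell+n-m}\rangle_\wp$, $A^{2,0}_{ijmn}=\langle[a_{ji}]_{q_j}q^{-r\ell+n-m}\rangle_\wp$, $A^{2,2}_{ijmn}=\langle q_i^{a_{ij}}q^{n-m}\rangle_\wp$, $B^{1,1,\pm}_{ijmn}=\langle q_i^{\pm a_{ij}}(1-q^{-2r\ell})q^{n-m}\rangle_\wp$, $B^{1,2}_{ijmn}=\langle q_i^{a_{ij}}q^{-r\ell+n-m}\rangle_\wp$, $B^{2,1}_{ijmn}=\langle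 q_i^{-a_{ij}}q^{-r\ell+n-m}\rangle_\wp$, $A^{1,1}_{ijmn}=-\langle q_i^{a_{ij}}(q^{r\ell}-q^{-r\ell})^2q^{n-m}\rangle_\wp$, $A^{2,1}_{ijmn}=-A^{1,2}_{ijmn}=\langle q_i^{a_{ij}}(q^{-r\ell}-q^{r\ell})q^{n-m}\rangle_\wp$. **The specific $\tau$.** Put $\vartheta_0(z)=\log\big((e^{z/2}-e^{-z/2})/z\big)$ and, for $0\ne s\in\mathbb Z_\wp$, $\vartheta_s(z)=\log\big((e^{z/2}-\zeta^se^{-z/2})/(1-\zeta^s)\big)$, elements of $z\mathbb C[[z]]$. For $g\in\mathbb Z[q,q^{-1}]$ let $C(g)=\prod_{0\ne s\in\mathbb Z_\wp}(1-\zeta^s)^{\langle gq^{-s}\rangle_\wp}$ and $E(z,g)=C(g)\prod_{s\in\mathbb Z_\wp}\exp(\langle gq^{-s}\rangle_\wp\vartheta_s(z))$. Then $\tau$ is (sums over $s\in\mathbb Z_\wp$, prime $=d/dz$): $\tau^{0,0}_{ijmn}=-\sum_s\langle q_i^{-a_{ij}}[r\ell/r_j]_{q_j}[r\ell/r_i]_{q_i}q^{n-m-s}\rangle_\wp\vartheta_s''$, $\tau^{0,1}_{ijmn}=\sum_s\langle q_i^{-a_{ij}}[r\ell/r_i]_{q_i}(q^{-r\ell}-q^{r\ell})q^{n-m-s}\rangle_\wp\vartheta_s'$, $\tau^{1,0}_{ijmn}=\sum_s\langle q_i^{-a_{ij}}[r\ell/r_j]_{q_j}(q^{r\ell}-q^{-r\ell})q^{n-m-s}\rangle_\wp\vartheta_s'$,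 $\tau^{0,2}_{ijmn}=\sum_s\langle q_i^{-a_{ij}}[r\ell/r_i]_{q_i}q^{n-m-s}\rangle_\wp\vartheta_s'$, $\tau^{2,0}_{ijmn}=\sum_s\langle q_i^{-a_{ij}}[r\ell/r_j]_{q_j}q^{n-m-s}\rangle_\wp\vartheta_s'$, $\tau^{1,1}_{ijmn}=(-1)^{\langle q_i^{a_{ij}}(q^{r\ell}-q^{-r\ell})^2q^{n-m}\rangle_\wp}E(z,q_i^{-a_{ij}}(q^{r\ell}-q^{-r\ell})^2q^{n-m})$, $\tau^{1,2}_{ijmn}=(-1)^{\langle q_i^{a_{ij}}(q^{-r\ell}-q^{r\ell})q^{n-m}\rangle_\wp}E(z,q_i^{-a_{ij}}(q^{-r\ell}-q^{r\ell})q^{n-m})$, $\tau^{2,1}_{ijmn}=(-1)^{\langle q_i^{a_{ij}}(q^{-r\ell}-q^{r\ell})q^{n-m}\rangle_\wp}\zeta^{-2r\ell}E(z,q_i^{-a_{ij}}(q^{r\ell}-q^{-r\ell})q^{n-m})$, $\tau^{2,2}_{ijmn}=(-1)^{\langle q_i^{a_{ij}}q^{n-m}\rangle_\wp}\zeta^{n}E(z,-q_i^{-a_{ij}}q^{n-m})$. (This tuple lies in the set $\mathfrak T$ of tuples of elements $\tau^{a,b}_{ijmn}\in\mathbb C[[z]]$, invertible for $a,b\in\{1,2\}$, satisfying the compatibility conditions under which the construction below gives a quantum vertex algebra.) **The category $\mathcal M_{\wp,\tau}^\ell(\widehat{\mathfrak g})$.** Objects: vector spaces $W$ with fields $\xi^a_{i,m}(z)=\sum_n\xi_{i,m}^a(n)z^{-n-1}\in\mathcal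 E(W)$ ($i\in I$, $m\in\mathbb Z_\wp$, $a\in\{0,1^\pm,2^\pm\}$) satisfying the relations below. Expansion convention: in commutator relations $(z_1-z_2)^{-k}$ (resp. $(z_2-z_1)^{-k}$) is expanded in nonnegative powers of $z_2$ (resp. $z_1$); in the other relations the scalar factor on the left is expanded in nonnegative powers of $z_2$ and the one on the right in nonnegative powers of $z_1$. With $\epsilon_1,\epsilon_2\in\{\pm1\}$, $\epsilon=\epsilon_1\epsilon_2$: (1) $[\xi^0_{i,m}(z_1),\xi^0_{j,n}(z_2)]=\frac{A^{0,0}_{ijmn}}{(z_1-z_2)^2}-\frac{A^{0,0}_{jinm}}{(z_2-z_1)^2}+\tau^{0,0}_{ijmn}(z_1-z_2)-\tau^{0,0}_{jinm}(z_2-z_1)$; (2),(3) for $a=1,2$: $[\xi^0_{i,m}(z_1),\xi^{a^\pm}_{j,n}(z_2)]=\pm\xi^{a^\pm}_{j,n}(z_2)\Big(\frac{A^{0,a}_{ijmn}}{z_1-z_2}+\frac{A^{a,0}_{jinm}}{z_2-z_1}+\tau^{0,a}_{ijmn}(z_1-z_2)+\tau^{a,0}_{jinm}(z_2-z_1)\Big)$; (4) $(z_1-z_2)^{\epsilon B^{1,1,+}_{ijmn}}(z_2-z_1)^{-\epsilon B^{1,1,-}_{ijmn}}\tau^{1,1}_{ijmn}(z_1-z_2)^{\epsilon}\xi^{1^{\epsilon_1}}_{i,m}(z_1)\xi^{1^{\epsilon_2}}_{j,n}(z_2)=(z_2-z_1)^{\epsilon B^{1,1,+}_{jinm}}(z_1-z_2)^{-\epsilon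 B^{1,1,-}_{jinm}}\tau^{1,1}_{jinm}(z_2-z_1)^{\epsilon}\xi^{1^{\epsilon_2}}_{j,n}(z_2)\xi^{1^{\epsilon_1}}_{i,m}(z_1)$; (5) $(z_1-z_2)^{-\epsilon B^{1,2}_{ijmn}}(z_2-z_1)^{\epsilon B^{2,1}_{ijmn}}\tau^{1,2}_{ijmn}(z_1-z_2)^{\epsilon}\xi^{1^{\epsilon_1}}_{i,m}(z_1)\xi^{2^{\epsilon_2}}_{j,n}(z_2)=(z_2-z_1)^{\epsilon B^{1,2}_{jinm}}(z_1-z_2)^{-\epsilon B^{2,1}_{jinm}}\tau^{2,1}_{jinm}(z_2-z_1)^{\epsilon}\xi^{2^{\epsilon_2}}_{j,n}(z_2)\xi^{1^{\epsilon_1}}_{i,m}(z_1)$; (6) $(z_1-z_2)^{A^{2,2}_{ijmn}}\tau^{2,2}_{ijmn}(z_1-z_2)\xi^{2^\pm}_{i,m}(z_1)\xi^{2^\pm}_{j,n}(z_2)=-(z_2-z_1)^{A^{2,2}_{jinm}}\tau^{2,2}_{jinm}(z_2-z_1)\xi^{2^\pm}_{j,n}(z_2)\xi^{2^\pm}_{i,m}(z_1)$; (7) with $d=\delta_{ij}\max\{\delta_{mn},\delta_{m+2r\ell,n}\}$: $(z_1-z_2)^{d}\xi^{2^+}_{i,m}(z_1)\xi^{2^-}_{j,n}(z_2)=-\frac{(z_1-z_2)^{d+A^{2,2}_{ijmn}}\tau^{2,2}_{ijmn}(z_1-z_2)}{(z_2-z_1)^{A^{2,2}_{jinm}}\tau^{2,2}_{jinm}(z_2-z_1)}\xi^{2^-}_{j,n}(z_2)\xi^{2^+}_{i,m}(z_1)$.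 **$V_{\wp,\tau}'^{\ell}(\mathfrak g)$** is the nonlocal vertex algebra generated by elements $\xi^a_{i,m}$ with $(V',Y(\xi^a_{i,m},z))\in\mathcal M_{\wp,\tau}^\ell(\widehat{\mathfrak g})$ and universal for this property (any nonlocal vertex algebra with elements $\bar\xi^a_{i,m}$ whose fields satisfy (1)–(7) receives a unique homomorphism $\xi^a_{i,m}\mapsto\bar\xi^a_{i,m}$). **$V_{\wp,\tau}^{\ell}(\mathfrak g)$** is the quotient of $V_{\wp,\tau}'^{\ell}(\mathfrak g)$ by the ideal generated by, for $i,j\in I$, $m,n\in\mathbb Z_\wp$: (8) $\xi^{2^+}_{i,m}(0)\xi^{2^-}_{j,n}-\delta_{ij}\delta_{mn}\mathbf 1+\delta_{ij}\delta_{m+2r\ell,n}\xi^{1^+}_{i,m+r\ell}$; (9) $\pm(\xi^0_{i,m-r_i}(-1)-\xi^0_{i,m+r_i}(-1))\xi^{1^\pm}_{i,m}-\partial\xi^{1^\pm}_{i,m}-(\tau^{0,1}_{ii,m-r_i,m}(0)-\tau^{0,1}_{ii,m+r_i,m}(0))\xi^{1^\pm}_{i,m}$; (10) $\xi^{1^\pm}_{i,m}(-1-B^{1,1,+}_{iimm}+B^{1,1,-}_{iimm})\xi^{1^\mp}_{i,m}-(-1)^{B^{1,1,-}_{iimm}}\tau^{1,2}_{ii,m+r\ell,m}(0)\tau^{2,1}_{iim,m+r\ell}(0)^{-1}\mathbf 1$; (11) $\xi^{2^\pm}_{i,m-r_ia_{ij}}(0)\xi^{2^\pm}_{i,m-r_ia_{ij}-2r_i}(0)\cdots\xi^{2^\pm}_{i,m+r_ia_{ij}}(0)\xi^{2^\pm}_{j,m}$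 for $a_{ij}\le0$; (12) $\xi^{2^\pm}_{i,m+2r_i(\wp_i-1)}(0)\xi^{2^\pm}_{i,m+2r_i(\wp_i-2)}(0)\cdots\xi^{2^\pm}_{i,m+2r_i}(0)\xi^{2^\pm}_{i,m}$. It is a quantum vertex algebra whose operator $S_{\wp,\tau}(z)$ is determined by ($a,b\in\{1,2\}$): $S(\xi^0_{j,n}\otimes\xi^0_{i,m})=\xi^0_{j,n}\otimes\xi^0_{i,m}+\mathbf 1\otimes\mathbf 1\otimes\big((A^{0,0}_{ijmn}-A^{0,0}_{jinm})z^{-2}+\tau^{0,0}_{ijmn}(-z)-\tau^{0,0}_{jinm}(z)\big)$; $S(\xi^0_{j,n}\otimes\xi^{a^\pm}_{i,m})=\xi^0_{j,n}\otimes\xi^{a^\pm}_{i,m}\pm\mathbf 1\otimes\xi^{a^\pm}_{i,m}\otimes\big((A^{a,0}_{ijmn}-A^{0,a}_{jinm})z^{-1}-\tau^{a,0}_{ijmn}(-z)-\tau^{0,a}_{jinm}(z)\big)$; $S(\xi^{a^\pm}_{j,n}\otimes\xi^0_{i,m})=\xi^{a^\pm}_{j,n}\otimes\xi^0_{i,m}\mp\xi^{a^\pm}_{j,n}\otimes\mathbf 1\otimes\big((A^{0,a}_{ijmn}-A^{a,0}_{jinm})z^{-1}-\tau^{0,a}_{ijmn}(-z)-\tau^{a,0}_{jinm}(z)\big)$; $S(\xi^{b^{\epsilon_2}}_{j,n}\otimes\xi^{a^{\epsilon_1}}_{i,m})=(-1)^{\delta_{a,2}\delta_{b,2}}\xi^{b^{\epsilon_2}}_{j,n}\otimes\xi^{a^{\epsilon_1}}_{i,m}\otimes(-z)^{-\epsilon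 A^{a,b}_{ijmn}}z^{\epsilon A^{b,a}_{jinm}}\tau^{a,b}_{ijmn}(-z)^{-\epsilon}\tau^{b,a}_{jinm}(z)^{\epsilon}$. *)

theory Defs
  imports
    Complex_Main
    "HOL-Library.Poly_Mapping"
    "HOL-Computational_Algebra.Formal_Laurent_Series"
    "HOL-Algebra.Elementary_Groups"
begin

section \<open>Complex vector spaces and tensor products\<close>

class complex_vector = ab_group_add +
  fixes scaleC :: "complex \<Rightarrow> 'a \<Rightarrow> 'a"  (infixr \<open>*\<^sub>C\<close> 75)
  assumes scaleC_add_right: "c *\<^sub>C (x + y) = c *\<^sub>C x + c *\<^sub>C y"
    and scaleC_add_left: "(c + d) *\<^sub>C x = c *\<^sub>C x + d *\<^sub>C x"
    and scaleC_scaleC: "c *\<^sub>C d *\<^sub>C x = (c * d) *\<^sub>C x"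
    and scaleC_one: "1 *\<^sub>C x = x"

global_interpretation cvec: vector_space "scaleC :: complex \<Rightarrow> 'a \<Rightarrow> 'a :: complex_vector"
  by unfold_locales
     (simp_all add: scaleC_add_right scaleC_add_left scaleC_scaleC scaleC_one)

instantiation complex :: complex_vector
begin
definition scaleC_complex :: "complex \<Rightarrow> complex \<Rightarrow> complex" where
  "scaleC_complex = (*)"
instance by standard (simp_all add: scaleC_complex_def algebra_simps)
end

abbreviation clinear :: "('a::complex_vector \<Rightarrow> 'b::complex_vector) \<Rightarrow> bool" where
  "clinear \<equiv> Vector_Spaces.linear scaleC scaleC"

lemma scaleC_complex_eq: "c *\<^sub>C (x :: complex) = c * x"
  by (simp add: scaleC_complex_def)

lemma clinear_iff:
  "clinear f \<longleftrightarrow> (\<forall>x y. f (x + y) = f x + f y) \<and> (\<forall>c x. f (c *\<^sub>C x) = c *\<^sub>C f x)"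
  by (simp add: Vector_Spaces.linear_iff cvec.vector_space_axioms)

definition cbilinear :: "('a::complex_vector \<Rightarrow> 'b::complex_vector \<Rightarrow> 'c::complex_vector) \<Rightarrow> bool" where
  "cbilinear f \<longleftrightarrow> (\<forall>u. clinear (f u)) \<and> (\<forall>v. clinear (\<lambda>u. f u v))"

text \<open>A tensor is identified with the functional it induces on bilinear forms: over a field,
  bilinear forms separate the points of the algebraic tensor product.  The universal property
  is lemma \<open>tensor_universal\<close> below.\<close>

definition tensor_fun ::
    "('a::complex_vector \<times> 'b::complex_vector) list \<Rightarrow> ('a \<Rightarrow> 'b \<Rightarrow> complex) \<Rightarrow> complex" where
  "tensor_fun xs = (\<lambda>\<beta>. if cbilinear \<beta> then (\<Sum>(u, v)\<leftarrow>xs. \<beta> u v) else 0)"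

typedef (overloaded) ('a::complex_vector, 'b::complex_vector) tensor
  = "range (tensor_fun :: ('a \<times> 'b) list \<Rightarrow> _)"
  by blast

setup_lifting type_definition_tensor

lift_definition pure_tensor ::
    "'a::complex_vector \<Rightarrow> 'b::complex_vector \<Rightarrow> ('a, 'b) tensor"  (infixr \<open>\<boxtimes>\<close> 76)
  is "\<lambda>u v. tensor_fun [(u, v)]"
  by blast

lemma tensor_fun_append: "tensor_fun (xs @ ys) \<beta> = tensor_fun xs \<beta> + tensor_fun ys \<beta>"
  by (simp add: tensor_fun_def)

lemma tensor_fun_scale:
  "tensor_fun (map (\<lambda>(u, v). (c *\<^sub>C u, v)) xs) \<beta> = c * tensor_fun xs \<beta>"
proof -
  have "(\<Sum>(u, v)\<leftarrow>map (\<lambda>(u, v). (c *\<^sub>C u, v)) xs. \<beta> u v) = c * (\<Sum>(u, v)\<leftarrow>xs. \<beta> u v)"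
    if "cbilinear \<beta>"
    using that
    by (induction xs) (auto simp: cbilinear_def clinear_iff scaleC_complex_eq algebra_simps)
  thus ?thesis by (simp add: tensor_fun_def)
qed

instantiation tensor :: (complex_vector, complex_vector) complex_vector
begin

lift_definition zero_tensor :: "('a, 'b) tensor" is "\<lambda>_. 0"
  by (rule range_eqI[of _ _ "[]"]) (simp add: tensor_fun_def fun_eq_iff)

lift_definition plus_tensor :: "('a, 'b) tensor \<Rightarrow> ('a, 'b) tensor \<Rightarrow> ('a, 'b) tensor"
  is "\<lambda>s t \<beta>. s \<beta> + t \<beta>"
proof -
  fix s t :: "('a \<Rightarrow> 'b \<Rightarrow> complex) \<Rightarrow> complex"
  assume "s \<in> range tensor_fun" "t \<in> range tensor_fun"
  then obtain xs ys where "s = tensor_fun xs" "t = tensor_fun ys" by auto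
  hence "(\<lambda>\<beta>. s \<beta> + t \<beta>) = tensor_fun (xs @ ys)"
    by (simp add: tensor_fun_append fun_eq_iff)
  thus "(\<lambda>\<beta>. s \<beta> + t \<beta>) \<in> range tensor_fun" by simp
qed

lift_definition scaleC_tensor :: "complex \<Rightarrow> ('a, 'b) tensor \<Rightarrow> ('a, 'b) tensor"
  is "\<lambda>c t \<beta>. c * t \<beta>"
proof -
  fix c :: complex and t :: "('a \<Rightarrow> 'b \<Rightarrow> complex) \<Rightarrow> complex"
  assume "t \<in> range tensor_fun"
  then obtain xs where "t = tensor_fun xs" by auto
  hence "(\<lambda>\<beta>. c * t \<beta>) = tensor_fun (map (\<lambda>(u, v). (c *\<^sub>C u, v)) xs)"
    by (simp add: tensor_fun_scale fun_eq_iff)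
  thus "(\<lambda>\<beta>. c * t \<beta>) \<in> range tensor_fun" by simp
qed

definition uminus_tensor :: "('a, 'b) tensor \<Rightarrow> ('a, 'b) tensor" where
  "uminus_tensor t = (-1) *\<^sub>C t"

definition minus_tensor :: "('a, 'b) tensor \<Rightarrow> ('a, 'b) tensor \<Rightarrow> ('a, 'b) tensor" where
  "minus_tensor s t = s + (- t)"

instance
proof
  fix s t r :: "('a, 'b) tensor" and c d :: complex
  show "s + t + r = s + (t + r)" by transfer (simp add: algebra_simps)
  show "s + t = t + s" by transfer (simp add: algebra_simps)
  show "0 + s = s" by transfer simp
  show "- s + s = 0" unfolding uminus_tensor_def by transfer simp
  show "s - t = s + - t" by (rule minus_tensor_def)
  show "c *\<^sub>C (s + t) = c *\<^sub>C s + c *\<^sub>C t" by transfer (simp add: algebra_simps)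
  show "(c + d) *\<^sub>C s = c *\<^sub>C s + d *\<^sub>C s" by transfer (simp add: algebra_simps)
  show "c *\<^sub>C d *\<^sub>C s = (c * d) *\<^sub>C s" by transfer (simp add: algebra_simps)
  show "1 *\<^sub>C s = s" by transfer simp
qed

end

lemma cbilinear_pure_tensor: "cbilinear (\<boxtimes>)"
  unfolding cbilinear_def clinear_iff
  by (intro conjI allI; transfer)
     (auto simp: tensor_fun_def fun_eq_iff cbilinear_def clinear_iff scaleC_complex_eq)

lemma Rep_sum_pure_tensor: "Rep_tensor (\<Sum>(u, v)\<leftarrow>xs. u \<boxtimes> v) = tensor_fun xs"
  by (induction xs)
     (auto simp: zero_tensor.rep_eq plus_tensor.rep_eq pure_tensor.rep_eq tensor_fun_def fun_eq_iff)

lemma tensor_is_sum: "\<exists>xs. t = (\<Sum>(u, v)\<leftarrow>xs. u \<boxtimes> v)"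
proof -
  obtain xs where "Rep_tensor t = tensor_fun xs" using Rep_tensor[of t] by auto
  thus ?thesis by (metis Rep_sum_pure_tensor Rep_tensor_inject)
qed

lemma exists_functional:
  fixes x :: "'a::complex_vector"
  assumes "x \<noteq> 0"
  shows "\<exists>\<phi> :: 'a \<Rightarrow> complex. clinear \<phi> \<and> \<phi> x \<noteq> 0"
proof -
  interpret vp: vector_space_pair "scaleC :: complex \<Rightarrow> 'a \<Rightarrow> 'a" "scaleC :: complex \<Rightarrow> complex \<Rightarrow> complex" ..
  have "cvec.independent {x}" using assms by simp
  hence "clinear (vp.construct {x} (\<lambda>_. 1 :: complex))" "vp.construct {x} (\<lambda>_. 1 :: complex) x = 1"
    by (auto intro: vp.linear_construct vp.construct_basis)
  thus ?thesis by (metis zero_neq_one)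
qed

lemma tensor_universal:
  fixes f :: "'a::complex_vector \<Rightarrow> 'b::complex_vector \<Rightarrow> 'c::complex_vector"
  assumes f: "cbilinear f"
  shows "\<exists>!g. clinear g \<and> (\<forall>u v. g (u \<boxtimes> v) = f u v)"
proof -
  let ?T = "\<lambda>xs :: ('a \<times> 'b) list. \<Sum>(u, v)\<leftarrow>xs. u \<boxtimes> v"
  let ?F = "\<lambda>xs. \<Sum>(u, v)\<leftarrow>xs. f u v"
  have wd: "?F xs = ?F ys" if eq: "?T xs = ?T ys" for xs ys
  proof (rule ccontr)
    assume "?F xs \<noteq> ?F ys"
    then obtain \<phi> :: "'c \<Rightarrow> complex" where \<phi>: "clinear \<phi>" "\<phi> (?F xs - ?F ys) \<noteq> 0"
      using exists_functional[of "?F xs - ?F ys"] by auto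
    let ?\<beta> = "\<lambda>u v. \<phi> (f u v)"
    have bil: "cbilinear ?\<beta>"
      using f \<phi>(1) by (auto simp: cbilinear_def clinear_iff)
    have \<phi>0: "\<phi> 0 = 0" using \<phi>(1) unfolding clinear_iff by (metis add_cancel_right_left)
    have sums: "\<phi> (?F zs) = tensor_fun zs ?\<beta>" for zs
      using bil \<phi>(1) \<phi>0 by (induction zs) (auto simp: tensor_fun_def clinear_iff)
    have "tensor_fun xs = tensor_fun ys" using eq by (metis Rep_sum_pure_tensor)
    hence "\<phi> (?F xs) = \<phi> (?F ys)" by (simp add: sums)
    moreover have "\<phi> (?F xs - ?F ys) = \<phi> (?F xs) - \<phi> (?F ys)"
      using \<phi>(1) unfolding clinear_iff by (metis add_diff_cancel_right' diff_add_cancel)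
    ultimately show False using \<phi>(2) by simp
  qed
  define rep where "rep t = (SOME xs. t = ?T xs)" for t
  have rep: "?T (rep t) = t" for t
    unfolding rep_def using someI_ex[OF tensor_is_sum[of t]] by simp
  define g where "g t = ?F (rep t)" for t
  have g: "g (?T xs) = ?F xs" for xs
    unfolding g_def by (rule wd) (rule rep)
  have "clinear g"
    unfolding clinear_iff
  proof (intro conjI allI)
    fix s t :: "('a, 'b) tensor" and c :: complex
    have "g (?T (rep s @ rep t)) = g s + g t" unfolding g by (simp add: g_def)
    thus "g (s + t) = g s + g t" by (simp add: rep)
    let ?m = "map (\<lambda>(u, v). (c *\<^sub>C u, v))"
    have "?T (?m xs) = c *\<^sub>C ?T xs" for xs
      using cbilinear_pure_tensor[where 'a='a and 'b='b]
      by (induction xs) (auto simp: cbilinear_def clinear_iff scaleC_add_right)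
    hence "c *\<^sub>C t = ?T (?m (rep t))" by (simp add: rep)
    moreover have "?F (?m xs) = c *\<^sub>C ?F xs" for xs
      using f by (induction xs) (auto simp: cbilinear_def clinear_iff scaleC_add_right)
    ultimately show "g (c *\<^sub>C t) = c *\<^sub>C g t" by (metis g rep)
  qed
  moreover have "g (u \<boxtimes> v) = f u v" for u v using g[of "[(u, v)]"] by simp
  moreover have "h = g" if h: "clinear h" "\<forall>u v. h (u \<boxtimes> v) = f u v" for h
  proof
    fix t
    have h0: "h 0 = 0" using h(1) unfolding clinear_iff by (metis add_cancel_right_left)
    have "h (?T xs) = ?F xs" for xs
      using h h0 by (induction xs) (auto simp: clinear_iff)
    thus "h t = g t" by (metis g rep)
  qed
  ultimately show ?thesis by blast
qed

definition tensor_lift ::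
    "('a::complex_vector \<Rightarrow> 'b::complex_vector \<Rightarrow> 'c::complex_vector) \<Rightarrow> ('a, 'b) tensor \<Rightarrow> 'c" where
  "tensor_lift f = (THE g. clinear g \<and> (\<forall>u v. g (u \<boxtimes> v) = f u v))"

lemma tensor_lift:
  assumes "cbilinear f"
  shows "clinear (tensor_lift f)" "tensor_lift f (u \<boxtimes> v) = f u v"
  using theI'[OF tensor_universal[OF assms]] by (auto simp: tensor_lift_def)

definition tensor_map ::
    "('a::complex_vector \<Rightarrow> 'c::complex_vector) \<Rightarrow> ('b::complex_vector \<Rightarrow> 'd::complex_vector) \<Rightarrow>
     ('a, 'b) tensor \<Rightarrow> ('c, 'd) tensor" where
  "tensor_map f g = tensor_lift (\<lambda>u v. f u \<boxtimes> g v)"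

definition tensor_swap ::
    "('a::complex_vector, 'b::complex_vector) tensor \<Rightarrow> ('b, 'a) tensor" where
  "tensor_swap = tensor_lift (\<lambda>u v. v \<boxtimes> u)"

definition tensor_assoc ::
    "(('a::complex_vector, 'b::complex_vector) tensor, 'c::complex_vector) tensor \<Rightarrow>
     ('a, ('b, 'c) tensor) tensor" where
  "tensor_assoc = tensor_lift (\<lambda>t w. tensor_lift (\<lambda>u v. u \<boxtimes> v \<boxtimes> w) t)"

definition tensor_unassoc ::
    "('a::complex_vector, ('b::complex_vector, 'c::complex_vector) tensor) tensor \<Rightarrow>
     (('a, 'b) tensor, 'c) tensor" where
  "tensor_unassoc = tensor_lift (\<lambda>u. tensor_lift (\<lambda>v w. (u \<boxtimes> v) \<boxtimes> w))"



section \<open>Simple Lie algebras and their Cartan matrices\<close>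

definition clinear_on :: "'a::complex_vector set \<Rightarrow> ('a \<Rightarrow> 'b::complex_vector) \<Rightarrow> bool" where
  "clinear_on W f \<longleftrightarrow>
     (\<forall>x\<in>W. \<forall>y\<in>W. f (x + y) = f x + f y) \<and> (\<forall>c. \<forall>x\<in>W. f (c *\<^sub>C x) = c *\<^sub>C f x)"

definition lie_algebra :: "('g::complex_vector \<Rightarrow> 'g \<Rightarrow> 'g) \<Rightarrow> bool" where
  "lie_algebra br \<longleftrightarrow> cbilinear br \<and> (\<forall>x. br x x = 0) \<and>
     (\<forall>x y z. br x (br y z) + br y (br z x) + br z (br x y) = 0)"

definition simple_lie_algebra :: "('g::complex_vector \<Rightarrow> 'g \<Rightarrow> 'g) \<Rightarrow> bool" where
  "simple_lie_algebra br \<longleftrightarrow> lie_algebra br \<and> (\<exists>x y. br x y \<noteq> 0) \<and>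
     (\<forall>I. cvec.subspace I \<and> (\<forall>x. \<forall>y\<in>I. br x y \<in> I) \<longrightarrow> I = {0} \<or> I = UNIV)"

primrec lower_central :: "('g::complex_vector \<Rightarrow> 'g \<Rightarrow> 'g) \<Rightarrow> 'g set \<Rightarrow> nat \<Rightarrow> 'g set" where
  "lower_central br H 0 = H"
| "lower_central br H (Suc k) = cvec.span {br x y | x y. x \<in> H \<and> y \<in> lower_central br H k}"

definition cartan_subalgebra :: "('g::complex_vector \<Rightarrow> 'g \<Rightarrow> 'g) \<Rightarrow> 'g set \<Rightarrow> bool" where
  "cartan_subalgebra br H \<longleftrightarrow> cvec.subspace H \<and> (\<forall>x\<in>H. \<forall>y\<in>H. br x y \<in> H) \<and>
     (\<exists>k. lower_central br H k = {0}) \<and> {x. \<forall>h\<in>H. br x h \<in> H} = H"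

text \<open>Elements of the dual of \<open>H\<close> are represented by functions on the whole Lie algebra of which
  only the restriction to \<open>H\<close> matters.\<close>

definition root_space :: "('g::complex_vector \<Rightarrow> 'g \<Rightarrow> 'g) \<Rightarrow> 'g set \<Rightarrow> ('g \<Rightarrow> complex) \<Rightarrow> 'g set" where
  "root_space br H \<beta> = {x. \<forall>h\<in>H. br h x = \<beta> h *\<^sub>C x}"

definition is_root :: "('g::complex_vector \<Rightarrow> 'g \<Rightarrow> 'g) \<Rightarrow> 'g set \<Rightarrow> ('g \<Rightarrow> complex) \<Rightarrow> bool" where
  "is_root br H \<beta> \<longleftrightarrow> clinear_on H \<beta> \<and> (\<exists>h\<in>H. \<beta> h \<noteq> 0) \<and> (\<exists>x\<in>root_space br H \<beta>. x \<noteq> 0)"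

definition simple_roots ::
    "('g::complex_vector \<Rightarrow> 'g \<Rightarrow> 'g) \<Rightarrow> 'g set \<Rightarrow> ('i::finite \<Rightarrow> 'g \<Rightarrow> complex) \<Rightarrow> bool" where
  "simple_roots br H \<alpha> \<longleftrightarrow>
     (\<forall>i. is_root br H (\<alpha> i)) \<and>
     (\<forall>c :: 'i \<Rightarrow> complex. (\<forall>h\<in>H. (\<Sum>i\<in>UNIV. c i * \<alpha> i h) = 0) \<longrightarrow> (\<forall>i. c i = 0)) \<and>
     (\<forall>\<beta>. is_root br H \<beta> \<longrightarrow>
        (\<exists>c :: 'i \<Rightarrow> int. (\<forall>h\<in>H. \<beta> h = (\<Sum>i\<in>UNIV. of_int (c i) * \<alpha> i h)) \<and>
           ((\<forall>i. c i \<ge> 0) \<or> (\<forall>i. c i \<le> 0))))"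

definition is_coroot ::
    "('g::complex_vector \<Rightarrow> 'g \<Rightarrow> 'g) \<Rightarrow> 'g set \<Rightarrow> ('g \<Rightarrow> complex) \<Rightarrow> 'g \<Rightarrow> bool" where
  "is_coroot br H \<beta> t \<longleftrightarrow>
     t \<in> cvec.span {br x y | x y. x \<in> root_space br H \<beta> \<and> y \<in> root_space br H (\<lambda>h. - \<beta> h)} \<and>
     \<beta> t = 2"

text \<open>Convention: \<open>a i j\<close> is the value of the simple root \<open>\<alpha> j\<close> on the coroot of \<open>\<alpha> i\<close>, so that
  the matrix of entries \<open>r\<^sub>i * a i j\<close> is symmetric.\<close>

definition simple_lie_datum ::
    "('g::complex_vector \<Rightarrow> 'g \<Rightarrow> 'g) \<Rightarrow> 'g set \<Rightarrow> ('i::finite \<Rightarrow> 'g \<Rightarrow> complex) \<Rightarrow>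
     ('i \<Rightarrow> 'i \<Rightarrow> int) \<Rightarrow> bool" where
  "simple_lie_datum br H \<alpha> a \<longleftrightarrow>
     simple_lie_algebra br \<and> (\<exists>B :: 'g set. finite B \<and> cvec.span B = UNIV) \<and>
     cartan_subalgebra br H \<and> simple_roots br H \<alpha> \<and>
     (\<forall>i j. \<exists>t. is_coroot br H (\<alpha> i) t \<and> of_int (a i j) = \<alpha> j t)"

definition endo_trace :: "('g::complex_vector \<Rightarrow> 'g) \<Rightarrow> complex" where
  "endo_trace f =
     (let B = SOME B. cvec.independent B \<and> cvec.span B = UNIV
      in \<Sum>b\<in>B. cvec.representation B (f b) b)"

definition killing_form :: "('g::complex_vector \<Rightarrow> 'g \<Rightarrow> 'g) \<Rightarrow> 'g \<Rightarrow> 'g \<Rightarrow> complex" where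
  "killing_form br x y = endo_trace (\<lambda>z. br x (br y z))"

text \<open>The squared length of \<open>\<beta>\<close> for the form on the dual of \<open>H\<close> induced by the Killing form.\<close>

definition root_norm :: "('g::complex_vector \<Rightarrow> 'g \<Rightarrow> 'g) \<Rightarrow> 'g set \<Rightarrow> ('g \<Rightarrow> complex) \<Rightarrow> real" where
  "root_norm br H \<beta> = Re (\<beta> (THE t. t \<in> H \<and> (\<forall>h\<in>H. killing_form br t h = \<beta> h)))"

definition short_root :: "('g::complex_vector \<Rightarrow> 'g \<Rightarrow> 'g) \<Rightarrow> 'g set \<Rightarrow> ('g \<Rightarrow> complex) \<Rightarrow> bool" where
  "short_root br H \<beta> \<longleftrightarrow> is_root br H \<beta> \<and> (\<forall>\<gamma>. is_root br H \<gamma> \<longrightarrow> root_norm br H \<beta> \<le> root_norm br H \<gamma>)"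

text \<open>The off-diagonal entries of the Cartan matrix show that this is 1 for the simply laced
  types, 2 for \<open>B\<close>, \<open>C\<close>, \<open>F\<^sub>4\<close> and 3 for \<open>G\<^sub>2\<close>.\<close>

definition lacing :: "('i::finite \<Rightarrow> 'i \<Rightarrow> int) \<Rightarrow> int" where
  "lacing a = Max (insert 1 {- a i j | i j. i \<noteq> j})"

definition root_weight ::
    "('g::complex_vector \<Rightarrow> 'g \<Rightarrow> 'g) \<Rightarrow> 'g set \<Rightarrow> ('i::finite \<Rightarrow> 'g \<Rightarrow> complex) \<Rightarrow>
     ('i \<Rightarrow> 'i \<Rightarrow> int) \<Rightarrow> 'i \<Rightarrow> int" where
  "root_weight br H \<alpha> a i = (if short_root br H (\<alpha> i) then 1 else lacing a)"


section \<open>Formal calculus in two variables\<close>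

unbundle fps_syntax

text \<open>A formal distribution in \<open>z\<^sub>1, z\<^sub>2\<close> is the function sending a pair of exponents to the
  coefficient; operator-valued series in one variable are likewise functions of the exponent.
  All sums below are finite where they are used; \<open>Sum_any\<close> sums over the support.\<close>

type_synonym 'v dist2 = "int \<Rightarrow> int \<Rightarrow> 'v"

text \<open>\<open>F(z\<^sub>1 - z\<^sub>2)\<close> expanded in nonnegative powers of \<open>z\<^sub>2\<close>, and \<open>F(z\<^sub>2 - z\<^sub>1)\<close> expanded in
  nonnegative powers of \<open>z\<^sub>1\<close>.\<close>

definition expand12 :: "complex fls \<Rightarrow> complex dist2" where
  "expand12 F x y =
     (if y < 0 then 0 else (-1) ^ nat y * (of_int (x + y) gchoose nat y) * F $$ (x + y))"

definition expand21 :: "complex fls \<Rightarrow> complex dist2" where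
  "expand21 F x y = expand12 F y x"

definition dist2_times :: "complex dist2 \<Rightarrow> 'v::complex_vector dist2 \<Rightarrow> 'v dist2" where
  "dist2_times c G x y = Sum_any (\<lambda>(k, l). c k l *\<^sub>C G (x - k) (y - l))"

text \<open>Multiplication by \<open>z\<^sub>1 - z\<^sub>2\<close>.\<close>

definition times_diff :: "'v::complex_vector dist2 \<Rightarrow> 'v dist2" where
  "times_diff G x y = G (x - 1) y - G x (y - 1)"

text \<open>Operator-valued series: \<open>F(z\<^sub>1)\<close>, \<open>F(z\<^sub>2)\<close>, \<open>F(z\<^sub>1 + z\<^sub>2)\<close>, \<open>F(z\<^sub>1 - z\<^sub>2)\<close>, \<open>F(z\<^sub>2 - z\<^sub>1)\<close>, the last
  three expanded in nonnegative powers of the second summand, and composition.\<close>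

definition at_z1 :: "(int \<Rightarrow> 'a \<Rightarrow> 'b::complex_vector) \<Rightarrow> ('a \<Rightarrow> 'b) dist2" where
  "at_z1 F x y t = (if y = 0 then F x t else 0)"

definition at_z2 :: "(int \<Rightarrow> 'a \<Rightarrow> 'b::complex_vector) \<Rightarrow> ('a \<Rightarrow> 'b) dist2" where
  "at_z2 F x y t = (if x = 0 then F y t else 0)"

definition at_z1_plus_z2 :: "(int \<Rightarrow> 'a \<Rightarrow> 'b::complex_vector) \<Rightarrow> ('a \<Rightarrow> 'b) dist2" where
  "at_z1_plus_z2 F x y t = (if y < 0 then 0 else (of_int (x + y) gchoose nat y) *\<^sub>C F (x + y) t)"

definition at_z1_minus_z2 :: "(int \<Rightarrow> 'a \<Rightarrow> 'b::complex_vector) \<Rightarrow> ('a \<Rightarrow> 'b) dist2" where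
  "at_z1_minus_z2 F x y t =
     (if y < 0 then 0 else ((-1) ^ nat y * (of_int (x + y) gchoose nat y)) *\<^sub>C F (x + y) t)"

definition at_z2_minus_z1 :: "(int \<Rightarrow> 'a \<Rightarrow> 'b::complex_vector) \<Rightarrow> ('a \<Rightarrow> 'b) dist2" where
  "at_z2_minus_z1 F x y = at_z1_minus_z2 F y x"

definition dist2_comp ::
    "('b \<Rightarrow> 'c::complex_vector) dist2 \<Rightarrow> ('a \<Rightarrow> 'b) dist2 \<Rightarrow> ('a \<Rightarrow> 'c) dist2" where
  "dist2_comp F G x y t = Sum_any (\<lambda>(k, l). F (x - k) (y - l) (G k l t))"


section \<open>Nonlocal vertex algebras\<close>

text \<open>A field \<open>\<Sum>\<^sub>n X(n) z\<^bsup>-n-1\<^esup>\<close> is given by its modes \<open>X(n)\<close>.  Vector spaces may be proper subspaces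
  \<open>W\<close> of an ambient type; operators are only constrained on \<open>W\<close>.\<close>

type_synonym 'v modes = "int \<Rightarrow> 'v \<Rightarrow> 'v"

definition field_on :: "'v::complex_vector set \<Rightarrow> 'v modes \<Rightarrow> bool" where
  "field_on W X \<longleftrightarrow> (\<forall>n. clinear_on W (X n) \<and> (\<forall>w\<in>W. X n w \<in> W)) \<and>
     (\<forall>w\<in>W. \<exists>N. \<forall>n\<ge>N. X n w = 0)"

text \<open>The coefficient of \<open>z\<^sub>1\<^bsup>x\<^esup> z\<^sub>2\<^bsup>y\<^esup>\<close> in \<open>X(z\<^sub>1) X'(z\<^sub>2) w\<close>.\<close>

definition field_prod :: "'v modes \<Rightarrow> 'v modes \<Rightarrow> 'v \<Rightarrow> 'v dist2" where
  "field_prod X X' w x y = X (- x - 1) (X' (- y - 1) w)"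

text \<open>The coefficient of \<open>z\<^sub>1\<^bsup>e ! 0\<^esup> \<dots> z\<^sub>k\<^bsup>e ! (k - 1)\<^esup>\<close> in \<open>Y(u\<^sub>1, z\<^sub>1) \<dots> Y(u\<^sub>k, z\<^sub>k) w\<close>.\<close>

definition field_prod_list :: "('v \<Rightarrow> 'v modes) \<Rightarrow> 'v list \<Rightarrow> 'v \<Rightarrow> int list \<Rightarrow> 'v" where
  "field_prod_list Y us w e = foldr (\<lambda>(u, x) t. Y u (- x - 1) t) (zip us e) w"

definition times_diff_list ::
    "nat \<Rightarrow> nat \<Rightarrow> (int list \<Rightarrow> 'v::complex_vector) \<Rightarrow> int list \<Rightarrow> 'v" where
  "times_diff_list i j G e = G (e[i := e ! i - 1]) - G (e[j := e ! j - 1])"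

definition times_all_diffs ::
    "nat \<Rightarrow> nat \<Rightarrow> (int list \<Rightarrow> 'v::complex_vector) \<Rightarrow> int list \<Rightarrow> 'v" where
  "times_all_diffs N k G =
     fold (\<lambda>(i, j). times_diff_list i j ^^ N) [(i, j). j \<leftarrow> [0..<k], i \<leftarrow> [0..<j]] G"

text \<open>Membership in \<open>W((z\<^sub>1, \<dots>, z\<^sub>k))\<close>.\<close>

definition laurent_list :: "nat \<Rightarrow> (int list \<Rightarrow> 'v::zero) \<Rightarrow> bool" where
  "laurent_list k G \<longleftrightarrow> (\<exists>M. \<forall>e. length e = k \<and> (\<exists>i<k. e ! i < M) \<longrightarrow> G e = 0)"

definition laurent2 :: "'v::zero dist2 \<Rightarrow> bool" where
  "laurent2 G \<longleftrightarrow> (\<exists>M. \<forall>x y. x < M \<or> y < M \<longrightarrow> G x y = 0)"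

text \<open>In the last clause, \<open>G\<close> is \<open>(z\<^sub>1 - z\<^sub>2)\<^bsup>N\<^esup> Y(u, z\<^sub>1) Y(v, z\<^sub>2) w\<close>, and the coefficients of
  \<open>z\<^sub>0\<^bsup>p - N\<^esup> z\<^sub>2\<^bsup>y\<^esup>\<close> are compared, \<open>z\<^sub>1 = z\<^sub>2 + z\<^sub>0\<close> being expanded in nonnegative powers of \<open>z\<^sub>0\<close>.\<close>

definition nonlocal_va ::
    "'v::complex_vector set \<Rightarrow> 'v \<Rightarrow> ('v \<Rightarrow> 'v modes) \<Rightarrow> bool" where
  "nonlocal_va V vac Y \<longleftrightarrow>
     cvec.subspace V \<and> vac \<in> V \<and>
     (\<forall>u\<in>V. field_on V (Y u)) \<and>
     (\<forall>n. \<forall>v\<in>V. clinear_on V (\<lambda>u. Y u n v)) \<and>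
     (\<forall>n. \<forall>v\<in>V. Y vac n v = (if n = -1 then v else 0)) \<and>
     (\<forall>u\<in>V. (\<forall>n\<ge>0. Y u n vac = 0) \<and> Y u (-1) vac = u) \<and>
     (\<forall>us. set us \<subseteq> V \<longrightarrow>
        (\<exists>N. \<forall>w\<in>V. laurent_list (length us)
           (times_all_diffs N (length us) (field_prod_list Y us w)))) \<and>
     (\<forall>u\<in>V. \<forall>v\<in>V. \<forall>N.
        (\<forall>w\<in>V. laurent2 ((times_diff ^^ N) (field_prod (Y u) (Y v) w))) \<longrightarrow>
        (\<forall>w\<in>V. let G = (times_diff ^^ N) (field_prod (Y u) (Y v) w) in
           \<forall>p y. Y (Y u (int N - p - 1) v) (- y - 1) w =
             (if p < 0 then 0
              else Sum_any (\<lambda>x. (of_int x gchoose nat p) *\<^sub>C G x (y - x + p)))))"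

definition va_derivation :: "'v \<Rightarrow> ('v \<Rightarrow> 'v modes) \<Rightarrow> 'v \<Rightarrow> 'v" where
  "va_derivation vac Y u = Y u (-2) vac"

definition va_generated_by ::
    "'v::complex_vector set \<Rightarrow> 'v \<Rightarrow> ('v \<Rightarrow> 'v modes) \<Rightarrow> 'v set \<Rightarrow> bool" where
  "va_generated_by V vac Y X \<longleftrightarrow> X \<subseteq> V \<and>
     V = \<Inter>{U. cvec.subspace U \<and> vac \<in> U \<and> X \<subseteq> U \<and> (\<forall>u\<in>U. \<forall>v\<in>U. \<forall>n. Y u n v \<in> U)}"

definition va_ideal :: "'v::complex_vector set \<Rightarrow> ('v \<Rightarrow> 'v modes) \<Rightarrow> 'v set \<Rightarrow> bool" where
  "va_ideal V Y J \<longleftrightarrow> cvec.subspace J \<and> J \<subseteq> V \<and>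
     (\<forall>u\<in>V. \<forall>v\<in>V. u \<in> J \<or> v \<in> J \<longrightarrow> (\<forall>n. Y u n v \<in> J))"

definition va_ideal_generated ::
    "'v::complex_vector set \<Rightarrow> ('v \<Rightarrow> 'v modes) \<Rightarrow> 'v set \<Rightarrow> 'v set" where
  "va_ideal_generated V Y X = \<Inter>{J. va_ideal V Y J \<and> X \<subseteq> J}"

definition nonlocal_va_hom ::
    "'v::complex_vector set \<Rightarrow> 'v \<Rightarrow> ('v \<Rightarrow> 'v modes) \<Rightarrow>
     'w::complex_vector set \<Rightarrow> 'w \<Rightarrow> ('w \<Rightarrow> 'w modes) \<Rightarrow> ('v \<Rightarrow> 'w) \<Rightarrow> bool" where
  "nonlocal_va_hom V vac Y V' vac' Y' f \<longleftrightarrow>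
     clinear_on V f \<and> (\<forall>v\<in>V. f v \<in> V') \<and> f vac = vac' \<and>
     (\<forall>u\<in>V. \<forall>v\<in>V. \<forall>n. f (Y u n v) = Y' (f u) n (f v))"


section \<open>Quantum vertex algebras\<close>

text \<open>Here the underlying vector space is a whole type.  The operator \<open>S(z)\<close> is given by the
  coefficients \<open>S k\<close> of \<open>z\<^bsup>k\<^esup>\<close>; a formal series over \<open>V \<otimes> V\<close> lies in \<open>V \<otimes> V \<otimes> \<complex>((z))\<close> iff its
  exponents are bounded below and its coefficients span a finite-dimensional space.
  The triple tensor product is \<open>V \<otimes> (V \<otimes> V)\<close>.\<close>

type_synonym 'v tensor2 = "('v, 'v) tensor"
type_synonym 'v tensor3 = "('v, ('v, 'v) tensor) tensor"

text \<open>The coefficient of \<open>z\<^bsup>k\<^esup>\<close> in \<open>t \<otimes> F(z)\<close>.\<close>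

definition series_tensor :: "'v::complex_vector \<Rightarrow> complex fls \<Rightarrow> int \<Rightarrow> 'v" where
  "series_tensor t F k = (F $$ k) *\<^sub>C t"

definition pos12 ::
    "('v::complex_vector tensor2 \<Rightarrow> 'v tensor2) \<Rightarrow> 'v tensor3 \<Rightarrow> 'v tensor3" where
  "pos12 f = tensor_assoc \<circ> tensor_map f id \<circ> tensor_unassoc"

definition pos23 ::
    "('v::complex_vector tensor2 \<Rightarrow> 'v tensor2) \<Rightarrow> 'v tensor3 \<Rightarrow> 'v tensor3" where
  "pos23 f = tensor_map id f"

definition pos13 ::
    "('v::complex_vector tensor2 \<Rightarrow> 'v tensor2) \<Rightarrow> 'v tensor3 \<Rightarrow> 'v tensor3" where
  "pos13 f = tensor_map id tensor_swap \<circ> pos12 f \<circ> tensor_map id tensor_swap"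

text \<open>\<open>Yz Y x\<close> is the coefficient of \<open>z\<^bsup>x\<^esup>\<close> in \<open>Y(z)\<close>.\<close>

definition Yz :: "('v::complex_vector \<Rightarrow> 'v modes) \<Rightarrow> int \<Rightarrow> 'v tensor2 \<Rightarrow> 'v" where
  "Yz Y x = tensor_lift (\<lambda>u v. Y u (- x - 1) v)"

definition Yz12 :: "('v::complex_vector \<Rightarrow> 'v modes) \<Rightarrow> int \<Rightarrow> 'v tensor3 \<Rightarrow> 'v tensor2" where
  "Yz12 Y x = tensor_map (Yz Y x) id \<circ> tensor_unassoc"

definition Yz23 :: "('v::complex_vector \<Rightarrow> 'v modes) \<Rightarrow> int \<Rightarrow> 'v tensor3 \<Rightarrow> 'v tensor2" where
  "Yz23 Y x = tensor_map id (Yz Y x)"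

definition quantum_va ::
    "'v::complex_vector \<Rightarrow> ('v \<Rightarrow> 'v modes) \<Rightarrow> (int \<Rightarrow> 'v tensor2 \<Rightarrow> 'v tensor2) \<Rightarrow> bool" where
  "quantum_va vac Y S \<longleftrightarrow>
     nonlocal_va UNIV vac Y \<and>
     (\<forall>k. clinear (S k)) \<and>
     (\<forall>t. (\<exists>M. \<forall>k<M. S k t = 0) \<and> (\<exists>B. finite B \<and> (\<forall>k. S k t \<in> cvec.span B))) \<and>
     (\<forall>v k. S k (v \<boxtimes> vac) = (if k = 0 then v \<boxtimes> vac else 0)) \<and>
     (\<forall>v k. S k (vac \<boxtimes> v) = (if k = 0 then vac \<boxtimes> v else 0)) \<and>
     dist2_comp (at_z1 S) (at_z2 (Yz12 Y)) =
       dist2_comp (at_z2 (Yz12 Y))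
         (dist2_comp (at_z1 (\<lambda>k. pos23 (S k))) (at_z1_plus_z2 (\<lambda>k. pos13 (S k)))) \<and>
     dist2_comp (at_z1 S) (at_z2 (Yz23 Y)) =
       dist2_comp (at_z2 (Yz23 Y))
         (dist2_comp (at_z1_minus_z2 (\<lambda>k. pos12 (S k))) (at_z1 (\<lambda>k. pos13 (S k)))) \<and>
     (\<forall>u v. \<exists>k. \<forall>w.
        (times_diff ^^ k) (field_prod (Y u) (Y v) w) =
        (times_diff ^^ k) (\<lambda>x y.
          dist2_comp (at_z2 (Yz Y))
            (dist2_comp (at_z1 (Yz23 Y)) (at_z2_minus_z1 (\<lambda>k. pos12 (S k)))) x y (v \<boxtimes> u \<boxtimes> w))) \<and>
     (\<forall>t n. Sum_any (\<lambda>k. ((-1) powi k) *\<^sub>C S (n - k) (tensor_swap (S k (tensor_swap t))))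
        = (if n = 0 then t else 0)) \<and>
     dist2_comp (at_z1 (\<lambda>k. pos12 (S k)))
       (dist2_comp (at_z1_plus_z2 (\<lambda>k. pos13 (S k))) (at_z2 (\<lambda>k. pos23 (S k)))) =
     dist2_comp (at_z2 (\<lambda>k. pos23 (S k)))
       (dist2_comp (at_z1_plus_z2 (\<lambda>k. pos13 (S k))) (at_z1 (\<lambda>k. pos12 (S k))))"

definition quantum_va_hom ::
    "'v::complex_vector \<Rightarrow> ('v \<Rightarrow> 'v modes) \<Rightarrow> (int \<Rightarrow> 'v tensor2 \<Rightarrow> 'v tensor2) \<Rightarrow>
     'w::complex_vector \<Rightarrow> ('w \<Rightarrow> 'w modes) \<Rightarrow> (int \<Rightarrow> 'w tensor2 \<Rightarrow> 'w tensor2) \<Rightarrow>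
     ('v \<Rightarrow> 'w) \<Rightarrow> bool" where
  "quantum_va_hom vac Y S vac' Y' S' f \<longleftrightarrow>
     nonlocal_va_hom UNIV vac Y UNIV vac' Y' f \<and>
     (\<forall>k t. tensor_map f f (S k t) = S' k (tensor_map f f t))"

definition quantum_va_aut_group ::
    "'v::complex_vector \<Rightarrow> ('v \<Rightarrow> 'v modes) \<Rightarrow> (int \<Rightarrow> 'v tensor2 \<Rightarrow> 'v tensor2) \<Rightarrow>
     ('v \<Rightarrow> 'v) monoid" where
  "quantum_va_aut_group vac Y S =
     \<lparr>carrier = {f. quantum_va_hom vac Y S vac Y S f \<and>
        (\<exists>g. quantum_va_hom vac Y S vac Y S g \<and> g \<circ> f = id \<and> f \<circ> g = id)},
      monoid.mult = (\<circ>), one = id\<rparr>"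

definition module_quantum_va ::
    "'s monoid \<Rightarrow> 'v::complex_vector \<Rightarrow> ('v \<Rightarrow> 'v modes) \<Rightarrow>
     (int \<Rightarrow> 'v tensor2 \<Rightarrow> 'v tensor2) \<Rightarrow> ('s \<Rightarrow> 'v \<Rightarrow> 'v) \<Rightarrow> bool" where
  "module_quantum_va G vac Y S R \<longleftrightarrow>
     quantum_va vac Y S \<and> R \<in> hom G (quantum_va_aut_group vac Y S)"


section \<open>The structure constants\<close>

text \<open>The ring \<open>\<int>[q, q\<^bsup>-1\<^esup>]\<close> is the group ring of \<open>\<int>\<close>.\<close>

type_synonym laurent_poly = "int \<Rightarrow>\<^sub>0 int"

definition qpow :: "int \<Rightarrow> laurent_poly" where
  "qpow k = Poly_Mapping.single k 1"

text \<open>\<open>qnum c n\<close> is \<open>[n]\<close> with respect to the base \<open>q\<^bsup>c\<^esup>\<close>, \<open>c \<noteq> 0\<close>.\<close>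

definition qnum :: "int \<Rightarrow> int \<Rightarrow> laurent_poly" where
  "qnum c n = (THE g. g * (qpow c - qpow (- c)) = qpow (c * n) - qpow (- (c * n)))"

lemma qpow_mult: "qpow k * qpow m = qpow (k + m)"
  by (simp add: qpow_def Poly_Mapping.mult_single)

lemma qnum_eq:
  assumes "c \<noteq> 0"
  shows "qnum c n * (qpow c - qpow (- c)) = qpow (c * n) - qpow (- (c * n))"
proof -
  have nat: "\<exists>g. g * (qpow c - qpow (- c)) = qpow (c * int k) - qpow (- (c * int k))" for k
  proof (induction k)
    case 0
    show ?case by (intro exI[of _ 0]) simp
  next
    case (Suc k)
    then obtain g where g: "g * (qpow c - qpow (- c)) = qpow (c * int k) - qpow (- (c * int k))"
      by blast
    have "(g * qpow c + qpow (- (c * int k))) * (qpow c - qpow (- c)) =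
        (g * (qpow c - qpow (- c))) * qpow c + qpow (- (c * int k)) * (qpow c - qpow (- c))"
      by (simp add: algebra_simps)
    also have "\<dots> = qpow (c * int (Suc k)) - qpow (- (c * int (Suc k)))"
      unfolding g by (simp add: qpow_mult algebra_simps)
    finally show ?case by blast
  qed
  have "\<exists>g. g * (qpow c - qpow (- c)) = qpow (c * n) - qpow (- (c * n))"
  proof (cases "n \<ge> 0")
    case True
    thus ?thesis using nat[of "nat n"] by simp
  next
    case False
    then obtain g where "g * (qpow c - qpow (- c)) = qpow (- (c * n)) - qpow (c * n)"
      using nat[of "nat (- n)"] by auto
    hence "(- g) * (qpow c - qpow (- c)) = qpow (c * n) - qpow (- (c * n))"
      by (simp add: algebra_simps)
    thus ?thesis by blast
  qed
  moreover have "Poly_Mapping.lookup (qpow c - qpow (- c)) c = 1"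
    using assms by (simp add: qpow_def lookup_minus lookup_single when_def)
  hence "qpow c - qpow (- c) \<noteq> 0" by force
  ultimately have "\<exists>!g. g * (qpow c - qpow (- c)) = qpow (c * n) - qpow (- (c * n))"
    by (metis mult_right_cancel)
  thus ?thesis unfolding qnum_def by (rule theI')
qed

definition residue_sum :: "nat \<Rightarrow> laurent_poly \<Rightarrow> int" where
  "residue_sum p g = (\<Sum>k\<in>{k \<in> Poly_Mapping.keys g. int p dvd k}. Poly_Mapping.lookup g k)"

definition theta :: "nat \<Rightarrow> complex \<Rightarrow> int \<Rightarrow> complex fps" where
  "theta p \<zeta> s = fps_ln 1 oo
     ((if int p dvd s then (fps_exp (1/2) - fps_exp (-1/2)) / fps_X
       else (fps_exp (1/2) - fps_const (\<zeta> powi s) * fps_exp (-1/2)) / fps_const (1 - \<zeta> powi s)) - 1)"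

definition Cfac :: "nat \<Rightarrow> complex \<Rightarrow> laurent_poly \<Rightarrow> complex" where
  "Cfac p \<zeta> g = (\<Prod>s\<in>{0<..<int p}. (1 - \<zeta> powi s) powi residue_sum p (g * qpow (- s)))"

definition Efac :: "nat \<Rightarrow> complex \<Rightarrow> laurent_poly \<Rightarrow> complex fps" where
  "Efac p \<zeta> g = fps_const (Cfac p \<zeta> g) *
     (\<Prod>s\<in>{0..<int p}. fps_exp (of_int (residue_sum p (g * qpow (- s)))) oo theta p \<zeta> s)"

text \<open>\<open>theta_sum p \<zeta> D g\<close> is the sum over \<open>s\<close> in \<open>\<int>/p\<int>\<close> of \<open>\<langle>g q\<^bsup>-s\<^esup>\<rangle> D(\<theta>\<^sub>s)\<close>.\<close>

definition theta_sum ::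
    "nat \<Rightarrow> complex \<Rightarrow> (complex fps \<Rightarrow> complex fps) \<Rightarrow> laurent_poly \<Rightarrow> complex fps" where
  "theta_sum p \<zeta> D g =
     (\<Sum>s\<in>{0..<int p}. fps_const (of_int (residue_sum p (g * qpow (- s)))) * D (theta p \<zeta> s))"

datatype sign = Plus | Minus

primrec sgn_val :: "sign \<Rightarrow> int" where
  "sgn_val Plus = 1"
| "sgn_val Minus = -1"

primrec opposite :: "sign \<Rightarrow> sign" where
  "opposite Plus = Minus"
| "opposite Minus = Plus"

datatype level = L0 | L1 | L2

text \<open>The labels \<open>0, 1\<^sup>+, 1\<^sup>-, 2\<^sup>+, 2\<^sup>-\<close> of the generators.\<close>

datatype label = G0 | G1 sign | G2 sign

text \<open>Families indexed by \<open>\<int>/p\<int>\<close> are represented by \<open>p\<close>-periodic families indexed by \<open>\<int>\<close>;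
  all formulas below depend on \<open>m\<close>, \<open>n\<close> only modulo \<open>p\<close>.\<close>

context
  fixes a :: "'i \<Rightarrow> 'i \<Rightarrow> int" and r :: int and d :: "'i \<Rightarrow> int"
    and p :: nat and \<zeta> :: complex and l :: int
begin

definition qi :: "'i \<Rightarrow> int \<Rightarrow> laurent_poly" where
  "qi i k = qpow (d i * k)"

text \<open>\<open>[r\<ell>/r\<^sub>i]\<close> with respect to the base \<open>q\<^sub>i\<close>; \<open>d i\<close> is \<open>r\<^sub>i\<close>, a divisor of \<open>r\<close>.\<close>

definition qlev :: "'i \<Rightarrow> laurent_poly" where
  "qlev i = qnum (d i) (r * l div d i)"

text \<open>\<open>qdiff = q\<^bsup>r\<ell>\<^esup> - q\<^bsup>-r\<ell>\<^esup>\<close>\<close>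

definition qdiff :: laurent_poly where
  "qdiff = qpow (r * l) - qpow (- (r * l))"

fun constA :: "level \<Rightarrow> level \<Rightarrow> 'i \<Rightarrow> 'i \<Rightarrow> int \<Rightarrow> int \<Rightarrow> int" where
  "constA L0 L0 i j m n = residue_sum p (qnum (d i) (a i j) * qlev j * qpow (- (r * l) + n - m))"
| "constA L0 L1 i j m n = residue_sum p (qnum (d i) (a i j) * (- qdiff) * qpow (- (r * l) + n - m))"
| "constA L1 L0 i j m n = residue_sum p (qnum (d j) (a j i) * qdiff * qpow (- (r * l) + n - m))"
| "constA L0 L2 i j m n = residue_sum p (qnum (d i) (a i j) * qpow (- (r * l) + n - m))"
| "constA L2 L0 i j m n = residue_sum p (qnum (d j) (a j i) * qpow (- (r * l) + n - m))"
| "constA L2 L2 i j m n = residue_sum p (qi i (a i j) * qpow (n - m))"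
| "constA L1 L1 i j m n = - residue_sum p (qi i (a i j) * qdiff ^ 2 * qpow (n - m))"
| "constA L2 L1 i j m n = residue_sum p (qi i (a i j) * (- qdiff) * qpow (n - m))"
| "constA L1 L2 i j m n = - residue_sum p (qi i (a i j) * (- qdiff) * qpow (n - m))"

definition constB11 :: "sign \<Rightarrow> 'i \<Rightarrow> 'i \<Rightarrow> int \<Rightarrow> int \<Rightarrow> int" where
  "constB11 e i j m n =
     residue_sum p (qi i (sgn_val e * a i j) * (1 - qpow (- 2 * r * l)) * qpow (n - m))"

definition constB12 :: "'i \<Rightarrow> 'i \<Rightarrow> int \<Rightarrow> int \<Rightarrow> int" where
  "constB12 i j m n = residue_sum p (qi i (a i j) * qpow (- (r * l) + n - m))"

definition constB21 :: "'i \<Rightarrow> 'i \<Rightarrow> int \<Rightarrow> int \<Rightarrow> int" where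
  "constB21 i j m n = residue_sum p (qi i (- a i j) * qpow (- (r * l) + n - m))"

fun tau :: "level \<Rightarrow> level \<Rightarrow> 'i \<Rightarrow> 'i \<Rightarrow> int \<Rightarrow> int \<Rightarrow> complex fps" where
  "tau L0 L0 i j m n =
     - theta_sum p \<zeta> (fps_deriv \<circ> fps_deriv) (qi i (- a i j) * qlev j * qlev i * qpow (n - m))"
| "tau L0 L1 i j m n =
     theta_sum p \<zeta> fps_deriv (qi i (- a i j) * qlev i * (- qdiff) * qpow (n - m))"
| "tau L1 L0 i j m n =
     theta_sum p \<zeta> fps_deriv (qi i (- a i j) * qlev j * qdiff * qpow (n - m))"
| "tau L0 L2 i j m n = theta_sum p \<zeta> fps_deriv (qi i (- a i j) * qlev i * qpow (n - m))"
| "tau L2 L0 i j m n = theta_sum p \<zeta> fps_deriv (qi i (- a i j) * qlev j * qpow (n - m))"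
| "tau L1 L1 i j m n =
     fps_const ((-1) powi residue_sum p (qi i (a i j) * qdiff ^ 2 * qpow (n - m))) *
     Efac p \<zeta> (qi i (- a i j) * qdiff ^ 2 * qpow (n - m))"
| "tau L1 L2 i j m n =
     fps_const ((-1) powi residue_sum p (qi i (a i j) * (- qdiff) * qpow (n - m))) *
     Efac p \<zeta> (qi i (- a i j) * (- qdiff) * qpow (n - m))"
| "tau L2 L1 i j m n =
     fps_const ((-1) powi residue_sum p (qi i (a i j) * (- qdiff) * qpow (n - m)) *
       \<zeta> powi (- 2 * r * l)) *
     Efac p \<zeta> (qi i (- a i j) * qdiff * qpow (n - m))"
| "tau L2 L2 i j m n =
     fps_const ((-1) powi residue_sum p (qi i (a i j) * qpow (n - m)) * \<zeta> powi n) *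
     Efac p \<zeta> (- qi i (- a i j) * qpow (n - m))"


section \<open>The algebra $V$ at level \<open>\<ell>\<close>\<close>

definition zmod_eq :: "int \<Rightarrow> int \<Rightarrow> bool" where
  "zmod_eq m n \<longleftrightarrow> int p dvd (m - n)"

fun lab :: "level \<Rightarrow> sign \<Rightarrow> label" where
  "lab L0 e = G0"
| "lab L1 e = G1 e"
| "lab L2 e = G2 e"

definition tauL :: "level \<Rightarrow> level \<Rightarrow> 'i \<Rightarrow> 'i \<Rightarrow> int \<Rightarrow> int \<Rightarrow> complex fls" where
  "tauL b c i j m n = fps_to_fls (tau b c i j m n)"

text \<open>\<open>\<tau>(-z)\<close>\<close>

definition tauL_neg :: "level \<Rightarrow> level \<Rightarrow> 'i \<Rightarrow> 'i \<Rightarrow> int \<Rightarrow> int \<Rightarrow> complex fls" where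
  "tauL_neg b c i j m n = fps_to_fls (tau b c i j m n oo (- fps_X))"

text \<open>\<open>c z\<^bsup>k\<^esup>\<close>\<close>

definition monomial :: "int \<Rightarrow> int \<Rightarrow> complex fls" where
  "monomial c k = of_int c * fls_X powi k"

text \<open>The scalar factors of the relations between two fields with labels \<open>1\<^sup>\<plusminus>\<close>, \<open>2\<^sup>\<plusminus>\<close>, written
  as functions of \<open>z = z\<^sub>1 - z\<^sub>2\<close> for the left-hand sides and of \<open>z = z\<^sub>2 - z\<^sub>1\<close> for the right-hand sides;
  the other difference is then \<open>-z\<close>.  \<open>factor21\<close> and \<open>factor22_ratio\<close> occur only on the right.\<close>

definition factor11 :: "int \<Rightarrow> 'i \<Rightarrow> 'i \<Rightarrow> int \<Rightarrow> int \<Rightarrow> complex fls" where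
  "factor11 e i j m n =
     fls_X powi (e * constB11 Plus i j m n) * (- fls_X) powi (- e * constB11 Minus i j m n) *
     tauL L1 L1 i j m n powi e"

definition factor12 :: "int \<Rightarrow> 'i \<Rightarrow> 'i \<Rightarrow> int \<Rightarrow> int \<Rightarrow> complex fls" where
  "factor12 e i j m n =
     fls_X powi (- e * constB12 i j m n) * (- fls_X) powi (e * constB21 i j m n) *
     tauL L1 L2 i j m n powi e"

definition factor21 :: "int \<Rightarrow> 'i \<Rightarrow> 'i \<Rightarrow> int \<Rightarrow> int \<Rightarrow> complex fls" where
  "factor21 e j i n m =
     fls_X powi (e * constB12 j i n m) * (- fls_X) powi (- e * constB21 j i n m) *
     tauL L2 L1 j i n m powi e"

definition factor22 :: "'i \<Rightarrow> 'i \<Rightarrow> int \<Rightarrow> int \<Rightarrow> complex fls" where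
  "factor22 i j m n = fls_X powi constA L2 L2 i j m n * tauL L2 L2 i j m n"

definition factor22_ratio :: "nat \<Rightarrow> 'i \<Rightarrow> 'i \<Rightarrow> int \<Rightarrow> int \<Rightarrow> complex fls" where
  "factor22_ratio k i j m n =
     ((- fls_X) powi (int k + constA L2 L2 i j m n) * tauL_neg L2 L2 i j m n) /
     (fls_X powi constA L2 L2 j i n m * tauL L2 L2 j i n m)"

definition category_M ::
    "'w::complex_vector set \<Rightarrow> (label \<Rightarrow> 'i \<Rightarrow> int \<Rightarrow> 'w modes) \<Rightarrow> bool" where
  "category_M W X \<longleftrightarrow>
     cvec.subspace W \<and>
     (\<forall>b i m. field_on W (X b i m)) \<and>
     (\<forall>b i m n. zmod_eq m n \<longrightarrow> X b i m = X b i n) \<and>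
     (\<forall>i j m n. \<forall>w\<in>W. \<forall>x y.
        field_prod (X G0 i m) (X G0 j n) w x y - field_prod (X G0 j n) (X G0 i m) w y x =
        (expand12 (monomial (constA L0 L0 i j m n) (-2) + tauL L0 L0 i j m n) x y
          - expand21 (monomial (constA L0 L0 j i n m) (-2) + tauL L0 L0 j i n m) x y) *\<^sub>C w) \<and>
     (\<forall>b\<in>{L1, L2}. \<forall>e i j m n. \<forall>w\<in>W. \<forall>x y.
        field_prod (X G0 i m) (X (lab b e) j n) w x y - field_prod (X (lab b e) j n) (X G0 i m) w y x =
        of_int (sgn_val e) *\<^sub>C dist2_times
          (\<lambda>x y. expand12 (monomial (constA L0 b i j m n) (-1) + tauL L0 b i j m n) x y
               + expand21 (monomial (constA b L0 j i n m) (-1) + tauL b L0 j i n m) x y)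
          (\<lambda>x y. if x = 0 then X (lab b e) j n (- y - 1) w else 0) x y) \<and>
     (\<forall>e1 e2 i j m n. \<forall>w\<in>W. \<forall>x y. let e = sgn_val e1 * sgn_val e2 in
        dist2_times (expand12 (factor11 e i j m n))
          (field_prod (X (G1 e1) i m) (X (G1 e2) j n) w) x y =
        dist2_times (expand21 (factor11 e j i n m))
          (\<lambda>x y. field_prod (X (G1 e2) j n) (X (G1 e1) i m) w y x) x y) \<and>
     (\<forall>e1 e2 i j m n. \<forall>w\<in>W. \<forall>x y. let e = sgn_val e1 * sgn_val e2 in
        dist2_times (expand12 (factor12 e i j m n))
          (field_prod (X (G1 e1) i m) (X (G2 e2) j n) w) x y =
        dist2_times (expand21 (factor21 e j i n m))
          (\<lambda>x y. field_prod (X (G2 e2) j n) (X (G1 e1) i m) w y x) x y) \<and>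
     (\<forall>e i j m n. \<forall>w\<in>W. \<forall>x y.
        dist2_times (expand12 (factor22 i j m n))
          (field_prod (X (G2 e) i m) (X (G2 e) j n) w) x y =
        - dist2_times (expand21 (factor22 j i n m))
          (\<lambda>x y. field_prod (X (G2 e) j n) (X (G2 e) i m) w y x) x y) \<and>
     (\<forall>i j m n. \<forall>w\<in>W. \<forall>x y.
        let k = (if i = j \<and> (zmod_eq m n \<or> zmod_eq (m + 2 * r * l) n) then 1 else 0 :: nat) in
        (times_diff ^^ k) (field_prod (X (G2 Plus) i m) (X (G2 Minus) j n) w) x y =
        - dist2_times (expand21 (factor22_ratio k i j m n))
          (\<lambda>x y. field_prod (X (G2 Minus) j n) (X (G2 Plus) i m) w y x) x y)"

text \<open>Any target of the universal property contains the subalgebra generated by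
  the given elements, which has countable dimension and hence is isomorphic to one carried by a
  subspace of the (infinite-dimensional) ambient type.  So it suffices to test the universal property
  against algebras carried by subspaces of that type.\<close>

definition is_Vprime ::
    "'v::complex_vector set \<Rightarrow> 'v \<Rightarrow> ('v \<Rightarrow> 'v modes) \<Rightarrow> (label \<Rightarrow> 'i \<Rightarrow> int \<Rightarrow> 'v) \<Rightarrow> bool" where
  "is_Vprime V vac Y \<xi> \<longleftrightarrow>
     (\<exists>B :: 'v set. cvec.independent B \<and> infinite B) \<and>
     nonlocal_va V vac Y \<and>
     (\<forall>b i m n. zmod_eq m n \<longrightarrow> \<xi> b i m = \<xi> b i n) \<and>
     va_generated_by V vac Y {\<xi> b i m | b i m. True} \<and>
     category_M V (\<lambda>b i m. Y (\<xi> b i m)) \<and>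
     (\<forall>(V' :: 'v set) vac' Y' \<eta>.
        nonlocal_va V' vac' Y' \<and> (\<forall>b i m. \<eta> b i m \<in> V') \<and>
        (\<forall>b i m n. zmod_eq m n \<longrightarrow> \<eta> b i m = \<eta> b i n) \<and>
        category_M V' (\<lambda>b i m. Y' (\<eta> b i m)) \<longrightarrow>
        (\<exists>f. nonlocal_va_hom V vac Y V' vac' Y' f \<and> (\<forall>b i m. f (\<xi> b i m) = \<eta> b i m) \<and>
          (\<forall>g. nonlocal_va_hom V vac Y V' vac' Y' g \<and> (\<forall>b i m. g (\<xi> b i m) = \<eta> b i m) \<longrightarrow>
             (\<forall>v\<in>V. g v = f v))))"

definition V_relators ::
    "'v::complex_vector \<Rightarrow> ('v \<Rightarrow> 'v modes) \<Rightarrow> (label \<Rightarrow> 'i \<Rightarrow> int \<Rightarrow> 'v) \<Rightarrow> 'v set" where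
  "V_relators vac Y \<xi> =
     {Y (\<xi> (G2 Plus) i m) 0 (\<xi> (G2 Minus) j n)
        - (if i = j \<and> zmod_eq m n then vac else 0)
        + (if i = j \<and> zmod_eq (m + 2 * r * l) n then \<xi> (G1 Plus) i (m + r * l) else 0)
      | i j m n. True} \<union>
     {of_int (sgn_val e) *\<^sub>C
        (Y (\<xi> G0 i (m - d i)) (-1) (\<xi> (G1 e) i m) - Y (\<xi> G0 i (m + d i)) (-1) (\<xi> (G1 e) i m))
        - va_derivation vac Y (\<xi> (G1 e) i m)
        - (tau L0 L1 i i (m - d i) m $ 0 - tau L0 L1 i i (m + d i) m $ 0) *\<^sub>C \<xi> (G1 e) i m
      | e i m. True} \<union>
     {Y (\<xi> (G1 e) i m) (-1 - constB11 Plus i i m m + constB11 Minus i i m m) (\<xi> (G1 (opposite e)) i m)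
        - ((-1) powi constB11 Minus i i m m * (tau L1 L2 i i (m + r * l) m $ 0) *
             inverse (tau L2 L1 i i m (m + r * l) $ 0)) *\<^sub>C vac
      | e i m. True} \<union>
     {foldr (\<lambda>k. Y (\<xi> (G2 e) i (m - d i * a i j - 2 * d i * int k)) 0)
        [0..<nat (1 - a i j)] (\<xi> (G2 e) j m)
      | e i j m. a i j \<le> 0} \<union>
     {foldr (\<lambda>k. Y (\<xi> (G2 e) i (m + 2 * d i * int k)) 0)
        (rev [1..<p div gcd p (nat (2 * d i))]) (\<xi> (G2 e) i m)
      | e i m. True}"

definition S_on_generators ::
    "'w::complex_vector \<Rightarrow> (int \<Rightarrow> 'w tensor2 \<Rightarrow> 'w tensor2) \<Rightarrow> (label \<Rightarrow> 'i \<Rightarrow> int \<Rightarrow> 'w) \<Rightarrow> bool" where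
  "S_on_generators vac S \<xi> \<longleftrightarrow>
     (\<forall>i j m n k. S k (\<xi> G0 j n \<boxtimes> \<xi> G0 i m) =
        series_tensor (\<xi> G0 j n \<boxtimes> \<xi> G0 i m) 1 k +
        series_tensor (vac \<boxtimes> vac)
          (monomial (constA L0 L0 i j m n - constA L0 L0 j i n m) (-2)
            + tauL_neg L0 L0 i j m n - tauL L0 L0 j i n m) k) \<and>
     (\<forall>b\<in>{L1, L2}. \<forall>e i j m n k. S k (\<xi> G0 j n \<boxtimes> \<xi> (lab b e) i m) =
        series_tensor (\<xi> G0 j n \<boxtimes> \<xi> (lab b e) i m) 1 k +
        of_int (sgn_val e) *\<^sub>C series_tensor (vac \<boxtimes> \<xi> (lab b e) i m)
          (monomial (constA b L0 i j m n - constA L0 b j i n m) (-1)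
            - tauL_neg b L0 i j m n - tauL L0 b j i n m) k) \<and>
     (\<forall>b\<in>{L1, L2}. \<forall>e i j m n k. S k (\<xi> (lab b e) j n \<boxtimes> \<xi> G0 i m) =
        series_tensor (\<xi> (lab b e) j n \<boxtimes> \<xi> G0 i m) 1 k -
        of_int (sgn_val e) *\<^sub>C series_tensor (\<xi> (lab b e) j n \<boxtimes> vac)
          (monomial (constA L0 b i j m n - constA b L0 j i n m) (-1)
            - tauL_neg L0 b i j m n - tauL b L0 j i n m) k) \<and>
     (\<forall>b\<in>{L1, L2}. \<forall>c\<in>{L1, L2}. \<forall>e1 e2 i j m n k. let e = sgn_val e1 * sgn_val e2 in
        S k (\<xi> (lab c e2) j n \<boxtimes> \<xi> (lab b e1) i m) =
        (if b = L2 \<and> c = L2 then -1 else 1) *\<^sub>C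
        series_tensor (\<xi> (lab c e2) j n \<boxtimes> \<xi> (lab b e1) i m)
          ((- fls_X) powi (- e * constA b c i j m n) * fls_X powi (e * constA c b j i n m) *
            tauL_neg b c i j m n powi (- e) * tauL c b j i n m powi e) k)"

text \<open>\<open>(UNIV, vac, Y, S)\<close> is the quotient of \<open>(V', vac', Y')\<close> by the ideal generated by the
  relators, with projection \<open>\<pi>\<close>, together with its quantum vertex algebra structure.\<close>

definition is_V ::
    "'v::complex_vector set \<Rightarrow> 'v \<Rightarrow> ('v \<Rightarrow> 'v modes) \<Rightarrow> (label \<Rightarrow> 'i \<Rightarrow> int \<Rightarrow> 'v) \<Rightarrow> ('v \<Rightarrow> 'w) \<Rightarrow>
     'w::complex_vector \<Rightarrow> ('w \<Rightarrow> 'w modes) \<Rightarrow> (int \<Rightarrow> 'w tensor2 \<Rightarrow> 'w tensor2) \<Rightarrow> bool" where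
  "is_V V' vac' Y' \<xi>' \<pi> vac Y S \<longleftrightarrow>
     is_Vprime V' vac' Y' \<xi>' \<and>
     nonlocal_va_hom V' vac' Y' UNIV vac Y \<pi> \<and>
     \<pi> ` V' = UNIV \<and>
     {v \<in> V'. \<pi> v = 0} = va_ideal_generated V' Y' (V_relators vac' Y' \<xi>') \<and>
     quantum_va vac Y S \<and>
     S_on_generators vac S (\<lambda>b i m. \<pi> (\<xi>' b i m))"

end

end

theory Submission
  imports Defs
begin

text \<open>All structure constants of \<open>V\<close> depend on \<open>m\<close> and \<open>n\<close> only through \<open>n - m\<close>, with one exception:
  \<open>\<tau>\<^sup>2\<^sup>,\<^sup>2\<close> contains the factor \<open>\<zeta>\<^sup>n\<close>.  Translating both indices by \<open>s\<close> multiplies it by \<open>\<zeta>\<^sup>s\<close>, and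
  this scalar cancels from every relation and from the formula for \<open>S(z)\<close>
  (\<open>category_M_shift\<close>, \<open>exchange_factor_shift\<close>).  Hence the universal property of \<open>V'\<close> yields an
  endomorphism \<open>\<xi>\<^sub>i\<^sub>,\<^sub>m \<mapsto> \<xi>\<^sub>i\<^sub>,\<^sub>m\<^sub>+\<^sub>s\<close>, which maps relators to relators and descends to an endomorphism
  \<open>R(s)\<close> of the nonlocal vertex algebra \<open>V\<close> (\<open>is_V_shift\<close>).  Homomorphisms are determined by their
  values on generators, which gives uniqueness, \<open>R(s) R(t) = R(s + t)\<close> and \<open>R(0) = 1\<close>; in particular
  \<open>R(s)\<close> is bijective and depends only on \<open>s\<close> modulo \<open>\<wp>\<close>.

  It remains to see that \<open>R(s)\<close> commutes with \<open>S(z)\<close>.  This holds on pairs of generators, and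
  \<open>quantum_va_homI\<close> extends it to \<open>V \<otimes> V\<close> by the two hexagon identities.  The identity for the left
  factor involves \<open>S\<^sup>2\<^sup>3(z\<^sub>1) S\<^sup>1\<^sup>3(z\<^sub>1 + z\<^sub>2)\<close>, so what \<open>S\<^sup>1\<^sup>3\<close> leaves in the last factor has to be controlled.
  Therefore the left factor is treated first, with the right factor in the set \<open>G\<close> consisting of the
  vacuum and the generators: \<open>S(z)\<close> maps \<open>V \<otimes> G\<close> into the span of \<open>V \<otimes> G\<close>.  The identity for the
  right factor then finishes the argument without such a restriction.  Since \<open>R(s)\<close> is injective, it
  may be moved through the sums in these identities without verifying that they are finite.\<close>

section \<open>Linear maps and tensor products\<close>

lemma clinear_compose:
  "clinear f \<Longrightarrow> clinear g \<Longrightarrow> clinear (\<lambda>x. g (f x))"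
  by (simp add: clinear_iff)

lemma clinear_id: "clinear (\<lambda>x. x)" "clinear id"
  by (simp_all add: clinear_iff)

lemma clinear_0: "clinear f \<Longrightarrow> f 0 = 0"
  unfolding clinear_iff by (metis add_cancel_right_left)

lemma clinear_UNIV: "clinear_on UNIV f \<longleftrightarrow> clinear f"
  by (auto simp: clinear_on_def clinear_iff)

lemma clinear_on_compose:
  assumes "clinear_on V f" "\<And>v. v \<in> V \<Longrightarrow> f v \<in> W" "clinear_on W g"
  shows "clinear_on V (\<lambda>v. g (f v))"
  using assms by (simp add: clinear_on_def)

lemma clinear_on_diff:
  assumes "clinear_on V f" "cvec.subspace V" "x \<in> V" "y \<in> V"
  shows "f (x - y) = f x - f y"
proof -
  have "x - y \<in> V" using assms by (simp add: cvec.subspace_diff)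
  hence "f (x - y + y) = f (x - y) + f y" using assms unfolding clinear_on_def by blast
  thus ?thesis by simp
qed

lemma clinear_on_0:
  assumes "clinear_on V f" "cvec.subspace V"
  shows "f 0 = 0"
  using clinear_on_diff[OF assms, of 0 0] assms(2) by (simp add: cvec.subspace_0)

lemma subspace_equalizer:
  assumes "clinear f" "clinear g"
  shows "cvec.subspace {x. f x = g x}"
  using assms clinear_0[OF assms(1)] clinear_0[OF assms(2)]
  by (auto simp: cvec.subspace_def clinear_iff)

lemma subspace_preimage:
  assumes "clinear f" "cvec.subspace U"
  shows "cvec.subspace {x. f x \<in> U}"
  using assms clinear_0[OF assms(1)] by (auto simp: cvec.subspace_def clinear_iff)

lemma subspace_Ball:
  assumes "\<And>i. i \<in> I \<Longrightarrow> cvec.subspace {x. P i x}"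
  shows "cvec.subspace {x. \<forall>i\<in>I. P i x}"
  using assms by (auto simp: cvec.subspace_def)

lemma subspace_All:
  assumes "\<And>i. cvec.subspace {x. P i x}"
  shows "cvec.subspace {x. \<forall>i. P i x}"
  using assms by (auto simp: cvec.subspace_def)

text \<open>No finiteness of the support is needed: an injective map preserves the support,
  and both sides vanish when it is infinite.\<close>

lemma clinear_inj_Sum_any:
  assumes "clinear f" "\<And>x. f x = 0 \<Longrightarrow> x = 0"
  shows "f (Sum_any g) = Sum_any (\<lambda>x. f (g x))"
proof -
  have "f (\<Sum>x\<in>A. g x) = (\<Sum>x\<in>A. f (g x))" for A
    using assms(1) clinear_0[OF assms(1)]
    by (induction A rule: infinite_finite_induct) (auto simp: clinear_iff)
  moreover have "{x. f (g x) \<noteq> 0} = {x. g x \<noteq> 0}"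
    using assms(2) clinear_0[OF assms(1)] by auto
  ultimately show ?thesis by (simp add: Sum_any.expand_set)
qed

lemma subspace_Sum_any:
  "cvec.subspace U \<Longrightarrow> (\<And>x. g x \<in> U) \<Longrightarrow> Sum_any g \<in> U"
  unfolding Sum_any.expand_set by (rule cvec.subspace_sum)

lemma pure_tensor_linear: "clinear (\<lambda>v. u \<boxtimes> v)" "clinear (\<lambda>u. u \<boxtimes> v)"
  using cbilinear_pure_tensor by (auto simp: cbilinear_def)

lemma cbilinearI:
  "(\<And>u. clinear (f u)) \<Longrightarrow> (\<And>v. clinear (\<lambda>u. f u v)) \<Longrightarrow> cbilinear f"
  by (simp add: cbilinear_def)

lemma tensor_subspace_UNIV:
  assumes "cvec.subspace U" "\<And>u v. u \<boxtimes> v \<in> U"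
  shows "t \<in> U"
proof -
  obtain xs where "t = (\<Sum>(u, v)\<leftarrow>xs. u \<boxtimes> v)" using tensor_is_sum by blast
  thus ?thesis
    using assms by (induction xs arbitrary: t) (auto intro: cvec.subspace_0 cvec.subspace_add)
qed

lemma tensor_linear_eqI:
  assumes "clinear f" "clinear g" "\<And>u v. f (u \<boxtimes> v) = g (u \<boxtimes> v)"
  shows "f t = g t"
  using tensor_subspace_UNIV[OF subspace_equalizer[OF assms(1,2)]] assms(3) by blast

lemma tensor_map:
  assumes "clinear f" "clinear g"
  shows "clinear (tensor_map f g)" "tensor_map f g (u \<boxtimes> v) = f u \<boxtimes> g v"
proof -
  have "cbilinear (\<lambda>u v. f u \<boxtimes> g v)"
    by (intro cbilinearI clinear_compose[OF assms(1)] clinear_compose[OF assms(2)] pure_tensor_linear)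
  from tensor_lift[OF this] show "clinear (tensor_map f g)" "tensor_map f g (u \<boxtimes> v) = f u \<boxtimes> g v"
    by (simp_all add: tensor_map_def)
qed

lemma cbilinear_flip_tensor: "cbilinear (\<lambda>u v. v \<boxtimes> u)"
  by (intro cbilinearI pure_tensor_linear)

lemma tensor_swap: "clinear tensor_swap" "tensor_swap (u \<boxtimes> v) = v \<boxtimes> u"
  by (simp_all add: tensor_swap_def tensor_lift[OF cbilinear_flip_tensor])

text \<open>The lift of a bilinear map depends linearly on that map.\<close>

lemma clinear_lift_param:
  assumes "\<And>w. cbilinear (f w)" "\<And>u v. clinear (\<lambda>w. f w u v)"
  shows "clinear (\<lambda>w. tensor_lift (f w) t)"
  unfolding clinear_iff
proof (intro conjI allI)
  note L = tensor_lift[OF assms(1)]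
  have sum: "clinear (\<lambda>t. tensor_lift (f x) t + tensor_lift (f y) t)" for x y
    using L(1)[of x] L(1)[of y] by (simp add: clinear_iff algebra_simps scaleC_add_right)
  have scale: "clinear (\<lambda>t. c *\<^sub>C tensor_lift (f x) t)" for x c
    using L(1)[of x] by (simp add: clinear_iff scaleC_add_right scaleC_scaleC mult.commute)
  show "tensor_lift (f (x + y)) t = tensor_lift (f x) t + tensor_lift (f y) t" for x y
    by (rule tensor_linear_eqI[OF L(1) sum]) (use assms(2) in \<open>simp add: L(2) clinear_iff\<close>)
  show "tensor_lift (f (c *\<^sub>C x)) t = c *\<^sub>C tensor_lift (f x) t" for x c
    by (rule tensor_linear_eqI[OF L(1) scale]) (use assms(2) in \<open>simp add: L(2) clinear_iff\<close>)
qed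

lemma cbilinear_assoc_inner: "cbilinear (\<lambda>u v. u \<boxtimes> v \<boxtimes> w)"
  by (intro cbilinearI clinear_compose[OF _ pure_tensor_linear(1)] pure_tensor_linear)

lemma cbilinear_assoc: "cbilinear (\<lambda>t w. tensor_lift (\<lambda>u v. u \<boxtimes> v \<boxtimes> w) t)"
  by (rule cbilinearI)
     (intro clinear_lift_param cbilinear_assoc_inner
        clinear_compose[OF pure_tensor_linear(1) pure_tensor_linear(1)],
      rule tensor_lift(1)[OF cbilinear_assoc_inner])

lemma tensor_assoc: "clinear tensor_assoc" "tensor_assoc ((u \<boxtimes> v) \<boxtimes> w) = u \<boxtimes> v \<boxtimes> w"
  by (simp_all add: tensor_assoc_def tensor_lift[OF cbilinear_assoc]
      tensor_lift(2)[OF cbilinear_assoc_inner])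

lemma cbilinear_unassoc_inner: "cbilinear (\<lambda>v w. (u \<boxtimes> v) \<boxtimes> w)"
  by (intro cbilinearI clinear_compose[OF _ pure_tensor_linear(2)] pure_tensor_linear)

lemma cbilinear_unassoc: "cbilinear (\<lambda>u. tensor_lift (\<lambda>v w. (u \<boxtimes> v) \<boxtimes> w))"
  by (rule cbilinearI) (rule tensor_lift(1)[OF cbilinear_unassoc_inner],
      intro clinear_lift_param cbilinear_unassoc_inner
        clinear_compose[OF pure_tensor_linear(2) pure_tensor_linear(2)])

lemma tensor_unassoc:
  "clinear tensor_unassoc" "tensor_unassoc (u \<boxtimes> v \<boxtimes> w) = (u \<boxtimes> v) \<boxtimes> w"
  by (simp_all add: tensor_unassoc_def tensor_lift[OF cbilinear_unassoc]
      tensor_lift(2)[OF cbilinear_unassoc_inner])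

text \<open>Injective linear maps over a field have linear left inverses, and these can be tensored.\<close>

lemma tensor_map_inj:
  assumes "clinear f" "inj f" "clinear g" "inj g" "tensor_map f g t = 0"
  shows "t = 0"
proof -
  interpret f: vector_space_pair "scaleC :: complex \<Rightarrow> 'a \<Rightarrow> 'a" "scaleC :: complex \<Rightarrow> 'b \<Rightarrow> 'b" ..
  interpret g: vector_space_pair "scaleC :: complex \<Rightarrow> 'c \<Rightarrow> 'c" "scaleC :: complex \<Rightarrow> 'd \<Rightarrow> 'd" ..
  obtain f' where f': "clinear f'" "f' \<circ> f = id"
    using f.linear_injective_left_inverse[OF assms(1,2)] by blast
  obtain g' where g': "clinear g'" "g' \<circ> g = id"
    using g.linear_injective_left_inverse[OF assms(3,4)] by blast
  note m = tensor_map[OF assms(1,3)] and m' = tensor_map[OF f'(1) g'(1)]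
  have "tensor_map f' g' (tensor_map f g t) = t"
    by (rule tensor_linear_eqI[OF clinear_compose[OF m(1) m'(1)] clinear_id(1)])
       (use f'(2) g'(2) in \<open>simp add: m m' fun_eq_iff\<close>)
  thus ?thesis using assms(5) clinear_0[OF m'(1)] by simp
qed

lemma pos12_pure:
  assumes "clinear f"
  shows "pos12 f (u \<boxtimes> v \<boxtimes> w) = tensor_assoc (f (u \<boxtimes> v) \<boxtimes> w)"
  by (simp add: pos12_def tensor_unassoc tensor_map[OF assms clinear_id(2)])

lemma pos23_pure:
  assumes "clinear f"
  shows "pos23 f (u \<boxtimes> t) = u \<boxtimes> f t"
  by (simp add: pos23_def tensor_map[OF clinear_id(2) assms])

lemma clinear_pos12:
  assumes "clinear f"
  shows "clinear (pos12 f)"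
  unfolding pos12_def comp_def
  by (intro clinear_compose[OF _ tensor_assoc(1)] clinear_compose[OF tensor_unassoc(1)]
      tensor_map(1)[OF assms clinear_id(2)])

lemma clinear_pos23:
  assumes "clinear f"
  shows "clinear (pos23 f)"
  unfolding pos23_def by (rule tensor_map(1)[OF clinear_id(2) assms])

text \<open>The map \<open>a \<otimes> c \<mapsto> a \<otimes> v \<otimes> c\<close>, through which an operator in positions 1 and 3 acts on \<open>u \<otimes> v \<otimes> w\<close>.\<close>

definition tensor_insert ::
    "'b::complex_vector \<Rightarrow> ('a::complex_vector, 'c::complex_vector) tensor \<Rightarrow>
     ('a, ('b, 'c) tensor) tensor" where
  "tensor_insert v t = tensor_map id tensor_swap (tensor_assoc (t \<boxtimes> v))"

lemma tensor_insert: "clinear (tensor_insert v)" "tensor_insert v (a \<boxtimes> c) = a \<boxtimes> v \<boxtimes> c"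
  unfolding tensor_insert_def
  by (intro clinear_compose[OF _ tensor_map(1)[OF clinear_id(2) tensor_swap(1)]]
        clinear_compose[OF pure_tensor_linear(2) tensor_assoc(1)])
     (simp add: tensor_assoc tensor_map[OF clinear_id(2) tensor_swap(1)] tensor_swap)

lemma pos13_pure:
  assumes "clinear f"
  shows "pos13 f (u \<boxtimes> v \<boxtimes> w) = tensor_insert v (f (u \<boxtimes> w))"
  by (simp add: pos13_def pos12_pure[OF assms] tensor_insert_def
      tensor_map[OF clinear_id(2) tensor_swap(1)] tensor_swap)

section \<open>Homomorphisms of nonlocal vertex algebras\<close>

lemma nonlocal_vaD:
  assumes "nonlocal_va V vac Y"
  shows "cvec.subspace V" "vac \<in> V" "u \<in> V \<Longrightarrow> v \<in> V \<Longrightarrow> Y u n v \<in> V"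
    "u \<in> V \<Longrightarrow> clinear_on V (Y u n)" "v \<in> V \<Longrightarrow> clinear_on V (\<lambda>u. Y u n v)"
  using assms by (auto simp: nonlocal_va_def field_on_def)

lemma nonlocal_va_homD:
  assumes "nonlocal_va_hom V vac Y W vac' Y' f"
  shows "clinear_on V f" "v \<in> V \<Longrightarrow> f v \<in> W" "f vac = vac'"
    "u \<in> V \<Longrightarrow> v \<in> V \<Longrightarrow> f (Y u n v) = Y' (f u) n (f v)"
  using assms by (auto simp: nonlocal_va_hom_def)

lemma nonlocal_va_hom_compose:
  assumes "nonlocal_va_hom V1 vac1 Y1 V2 vac2 Y2 f" "nonlocal_va_hom V2 vac2 Y2 V3 vac3 Y3 g"
  shows "nonlocal_va_hom V1 vac1 Y1 V3 vac3 Y3 (g \<circ> f)"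
  using assms clinear_on_compose[of V1 f V2 g] by (simp add: nonlocal_va_hom_def comp_def)

lemma va_generated_by_least:
  assumes "va_generated_by V vac Y X" "cvec.subspace U" "vac \<in> U" "X \<subseteq> U"
    and "\<And>u v n. u \<in> U \<Longrightarrow> v \<in> U \<Longrightarrow> Y u n v \<in> U"
  shows "V \<subseteq> U"
proof -
  have "V = \<Inter>{U. cvec.subspace U \<and> vac \<in> U \<and> X \<subseteq> U \<and> (\<forall>u\<in>U. \<forall>v\<in>U. \<forall>n. Y u n v \<in> U)}"
    using assms(1) unfolding va_generated_by_def by (rule conjunct2)
  thus ?thesis using assms(2-) by blast
qed

lemma nonlocal_va_hom_eq_on_generators:
  assumes V: "nonlocal_va V vac Y" and W: "nonlocal_va W vac' Y'"
    and gen: "va_generated_by V vac Y X"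
    and f: "nonlocal_va_hom V vac Y W vac' Y' f" and g: "nonlocal_va_hom V vac Y W vac' Y' g"
    and eq: "\<And>x. x \<in> X \<Longrightarrow> f x = g x" and v: "v \<in> V"
  shows "f v = g v"
proof -
  let ?U = "{v \<in> V. f v = g v}"
  have lin: "clinear_on V f" "clinear_on V g"
    using nonlocal_va_homD(1) f g by blast+
  have "cvec.subspace ?U"
    using nonlocal_vaD(1)[OF V] lin clinear_on_0[OF lin(1) nonlocal_vaD(1)[OF V]]
      clinear_on_0[OF lin(2) nonlocal_vaD(1)[OF V]]
    by (auto simp: cvec.subspace_def clinear_on_def)
  moreover have "vac \<in> ?U"
    using nonlocal_vaD(2)[OF V] nonlocal_va_homD(3)[OF f] nonlocal_va_homD(3)[OF g] by simp
  moreover have "X \<subseteq> ?U" using conjunct1[OF gen[unfolded va_generated_by_def]] eq by auto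
  moreover have "Y u n v \<in> ?U" if "u \<in> ?U" "v \<in> ?U" for u v n
    using that nonlocal_vaD(3)[OF V] nonlocal_va_homD(4)[OF f] nonlocal_va_homD(4)[OF g] by simp
  ultimately have "V \<subseteq> ?U" by (rule va_generated_by_least[OF gen])
  thus ?thesis using v by blast
qed

lemma va_generated_by_image:
  assumes V: "nonlocal_va V vac Y" and W: "nonlocal_va W vac' Y'"
    and gen: "va_generated_by V vac Y X"
    and f: "nonlocal_va_hom V vac Y W vac' Y' f" and surj: "f ` V = W"
  shows "va_generated_by W vac' Y' (f ` X)"
proof -
  have XV: "X \<subseteq> V" using conjunct1[OF gen[unfolded va_generated_by_def]] .
  have "W \<subseteq> U"
    if U: "cvec.subspace U" "vac' \<in> U" "f ` X \<subseteq> U" "\<forall>u\<in>U. \<forall>v\<in>U. \<forall>n. Y' u n v \<in> U" for U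
  proof -
    let ?P = "{v \<in> V. f v \<in> U}"
    have lin: "clinear_on V f" by (rule nonlocal_va_homD(1)[OF f])
    have "cvec.subspace ?P"
      using nonlocal_vaD(1)[OF V] lin U(1) clinear_on_0[OF lin nonlocal_vaD(1)[OF V]]
      by (auto simp: cvec.subspace_def clinear_on_def)
    moreover have "vac \<in> ?P" using nonlocal_vaD(2)[OF V] nonlocal_va_homD(3)[OF f] U(2) by simp
    moreover have "X \<subseteq> ?P" using U(3) XV by auto
    moreover have "Y u n v \<in> ?P" if "u \<in> ?P" "v \<in> ?P" for u v n
      using that nonlocal_vaD(3)[OF V] nonlocal_va_homD(4)[OF f] U(4) by simp
    ultimately have "V \<subseteq> ?P" by (rule va_generated_by_least[OF gen])
    thus "W \<subseteq> U" using surj by blast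
  qed
  moreover have XW: "f ` X \<subseteq> W" using surj XV by blast
  moreover have "\<Inter>{U. cvec.subspace U \<and> vac' \<in> U \<and> f ` X \<subseteq> U \<and>
      (\<forall>u\<in>U. \<forall>v\<in>U. \<forall>n. Y' u n v \<in> U)} \<subseteq> W"
    using XW by (intro Inter_lower) (simp add: nonlocal_vaD[OF W])
  ultimately show ?thesis
    unfolding va_generated_by_def by (intro conjI equalityI Inter_greatest) auto
qed

text \<open>The kernel of a homomorphism is an ideal.\<close>

lemma nonlocal_va_hom_zero_on_ideal:
  assumes V: "nonlocal_va V vac Y" and W: "nonlocal_va W vac' Y'"
    and f: "nonlocal_va_hom V vac Y W vac' Y' f"
    and X: "X \<subseteq> V" "\<And>x. x \<in> X \<Longrightarrow> f x = 0" and v: "v \<in> va_ideal_generated V Y X"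
  shows "f v = 0"
proof -
  note sV = nonlocal_vaD(1)[OF V] and sW = nonlocal_vaD(1)[OF W] and lin = nonlocal_va_homD(1)[OF f]
  have "cvec.subspace {v \<in> V. f v = 0}"
    using sV lin clinear_on_0[OF lin sV] by (auto simp: cvec.subspace_def clinear_on_def)
  moreover have "f (Y u n v) = 0" if "u \<in> V" "v \<in> V" "f u = 0 \<or> f v = 0" for u v n
    using that nonlocal_va_homD(2,4)[OF f] clinear_on_0[OF nonlocal_vaD(4)[OF W] sW]
      clinear_on_0[OF nonlocal_vaD(5)[OF W] sW] by metis
  ultimately have "va_ideal V Y {v \<in> V. f v = 0}"
    using nonlocal_vaD(3)[OF V] unfolding va_ideal_def by blast
  thus ?thesis using v X unfolding va_ideal_generated_def by blast
qed

lemma nonlocal_va_hom_descend: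
  assumes V: "nonlocal_va V vac Y"
    and \<pi>: "nonlocal_va_hom V vac Y W vac' Y' \<pi>" "\<pi> ` V = W"
    and h: "nonlocal_va_hom V vac Y U vac'' Y'' h"
    and ker: "\<And>v. v \<in> V \<Longrightarrow> \<pi> v = 0 \<Longrightarrow> h v = 0"
  shows "\<exists>f. nonlocal_va_hom W vac' Y' U vac'' Y'' f \<and> (\<forall>v\<in>V. f (\<pi> v) = h v)"
proof -
  note sV = nonlocal_vaD(1)[OF V] and \<pi>_lin = nonlocal_va_homD(1)[OF \<pi>(1)]
    and h_lin = nonlocal_va_homD(1)[OF h]
  define f where "f w = h (SOME v. v \<in> V \<and> \<pi> v = w)" for w
  have f: "f (\<pi> v) = h v" if v: "v \<in> V" for v
  proof -
    define v' where "v' = (SOME v'. v' \<in> V \<and> \<pi> v' = \<pi> v)"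
    have v': "v' \<in> V" "\<pi> v' = \<pi> v" unfolding v'_def using someI[of "\<lambda>v'. v' \<in> V \<and> \<pi> v' = \<pi> v" v] v by auto
    have "h (v' - v) = 0"
      using v v' by (intro ker) (simp_all add: clinear_on_diff[OF \<pi>_lin sV] cvec.subspace_diff[OF sV])
    thus ?thesis using v v' by (simp add: f_def v'_def clinear_on_diff[OF h_lin sV])
  qed
  have ex: "\<exists>v\<in>V. w = \<pi> v" if "w \<in> W" for w using that \<pi>(2) by blast
  have "nonlocal_va_hom W vac' Y' U vac'' Y'' f"
    unfolding nonlocal_va_hom_def clinear_on_def
  proof (intro conjI ballI allI)
    show "f vac' = vac''"
      using f[OF nonlocal_vaD(2)[OF V]] nonlocal_va_homD(3)[OF \<pi>(1)] nonlocal_va_homD(3)[OF h] by simp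
    fix x assume x: "x \<in> W"
    then obtain u where u: "u \<in> V" "x = \<pi> u" using ex by blast
    show "f x \<in> U" using u f nonlocal_va_homD(2)[OF h] by simp
    show "f (c *\<^sub>C x) = c *\<^sub>C f x" for c
      using u f[of u] f[of "c *\<^sub>C u"] \<pi>_lin h_lin cvec.subspace_scale[OF sV, of u c]
      by (simp add: clinear_on_def)
    fix y assume "y \<in> W"
    then obtain v where v: "v \<in> V" "y = \<pi> v" using ex by blast
    show "f (x + y) = f x + f y"
      using u v f[of u] f[of v] f[of "u + v"] \<pi>_lin h_lin cvec.subspace_add[OF sV, of u v]
      by (simp add: clinear_on_def)
    show "f (Y' x n y) = Y'' (f x) n (f y)" for n
      using u v f[of u] f[of v] f[of "Y u n v"] nonlocal_vaD(3)[OF V]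
        nonlocal_va_homD(4)[OF \<pi>(1)] nonlocal_va_homD(4)[OF h] by simp
  qed
  thus ?thesis using f by blast
qed

section \<open>Intertwining the operators \<open>S(z)\<close>\<close>

lemma dist2_comp_at_z1_at_z2:
  assumes "\<And>k. F k 0 = 0"
  shows "dist2_comp (at_z1 F) (at_z2 G) x y t = F x (G y t)"
proof -
  have "dist2_comp (at_z1 F) (at_z2 G) x y t = Sum_any (\<lambda>kl. F x (G y t) when kl = (0 :: int, y))"
    unfolding dist2_comp_def at_z1_def at_z2_def
    by (rule Sum_any.cong) (use assms in \<open>auto simp: when_def split: if_splits\<close>)
  thus ?thesis by simp
qed

text \<open>The coefficients of a composite are sums over supports whose finiteness is not assumed; this is
  why \<open>E\<close> has to be injective.\<close>

lemma dist2_comp_natural: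
  assumes "clinear E" "\<And>v. E v = 0 \<Longrightarrow> v = 0"
    and "\<And>k l. E (F (x - k) (y - l) (G k l t)) = F' (x - k) (y - l) (G' k l t')"
  shows "E (dist2_comp F G x y t) = dist2_comp F' G' x y t'"
proof -
  have "E (dist2_comp F G x y t) = Sum_any (\<lambda>kl. E (case kl of (k, l) \<Rightarrow> F (x - k) (y - l) (G k l t)))"
    unfolding dist2_comp_def by (rule clinear_inj_Sum_any[OF assms(1,2)])
  also have "\<dots> = dist2_comp F' G' x y t'"
    unfolding dist2_comp_def by (rule Sum_any.cong) (simp add: assms(3) split: prod.splits)
  finally show ?thesis .
qed

lemma dist2_comp_in_subspace:
  assumes "cvec.subspace U" "\<And>k l. F (x - k) (y - l) (G k l t) \<in> U"
  shows "dist2_comp F G x y t \<in> U"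
  unfolding dist2_comp_def by (rule subspace_Sum_any) (use assms in auto)

lemma quantum_vaD:
  assumes "quantum_va vac Y S"
  shows "nonlocal_va UNIV vac Y" "clinear (S k)"
    "S k (v \<boxtimes> vac) = (if k = 0 then v \<boxtimes> vac else 0)"
    "S k (vac \<boxtimes> v) = (if k = 0 then vac \<boxtimes> v else 0)"
    "dist2_comp (at_z1 S) (at_z2 (Yz12 Y)) =
       dist2_comp (at_z2 (Yz12 Y))
         (dist2_comp (at_z1 (\<lambda>k. pos23 (S k))) (at_z1_plus_z2 (\<lambda>k. pos13 (S k))))"
    "dist2_comp (at_z1 S) (at_z2 (Yz23 Y)) =
       dist2_comp (at_z2 (Yz23 Y))
         (dist2_comp (at_z1_minus_z2 (\<lambda>k. pos12 (S k))) (at_z1 (\<lambda>k. pos13 (S k))))"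
  using assms unfolding quantum_va_def by blast+

lemma Yz:
  assumes "nonlocal_va UNIV vac Y"
  shows "clinear (Yz Y x)" "Yz Y x (u \<boxtimes> v) = Y u (- x - 1) v"
proof -
  have "cbilinear (\<lambda>u v. Y u (- x - 1) v)"
    using assms by (auto simp: nonlocal_va_def field_on_def clinear_UNIV intro!: cbilinearI)
  from tensor_lift[OF this] show "clinear (Yz Y x)" "Yz Y x (u \<boxtimes> v) = Y u (- x - 1) v"
    by (simp_all add: Yz_def)
qed

lemma Yz12:
  assumes "nonlocal_va UNIV vac Y"
  shows "clinear (Yz12 Y x)" "Yz12 Y x (u \<boxtimes> v \<boxtimes> w) = Y u (- x - 1) v \<boxtimes> w"
proof -
  note m = tensor_map[OF Yz(1)[OF assms] clinear_id(2)]
  show "clinear (Yz12 Y x)"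
    unfolding Yz12_def comp_def by (rule clinear_compose[OF tensor_unassoc(1) m(1)])
  show "Yz12 Y x (u \<boxtimes> v \<boxtimes> w) = Y u (- x - 1) v \<boxtimes> w" for u v
    by (simp add: Yz12_def tensor_unassoc m Yz(2)[OF assms])
qed

lemma Yz23:
  assumes "nonlocal_va UNIV vac Y"
  shows "clinear (Yz23 Y x)" "Yz23 Y x (u \<boxtimes> t) = u \<boxtimes> Yz Y x t"
  by (simp_all add: Yz23_def tensor_map[OF clinear_id(2) Yz(1)[OF assms]])

lemma tensor_map3_assoc:
  assumes "clinear f"
  shows "tensor_map f (tensor_map f f) (tensor_assoc (t \<boxtimes> w)) = tensor_assoc (tensor_map f f t \<boxtimes> f w)"
proof -
  note m = tensor_map[OF assms assms] and m3 = tensor_map[OF assms tensor_map(1)[OF assms assms]]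
  show ?thesis
    by (rule tensor_linear_eqI[where t = t],
        intro clinear_compose[OF _ m3(1)] clinear_compose[OF pure_tensor_linear(2) tensor_assoc(1)],
        intro clinear_compose[OF _ tensor_assoc(1)] clinear_compose[OF m(1) pure_tensor_linear(2)])
       (simp add: tensor_assoc m m3)
qed

lemma tensor_map3_insert:
  assumes "clinear f"
  shows "tensor_map f (tensor_map f f) (tensor_insert v t) = tensor_insert (f v) (tensor_map f f t)"
proof -
  note m = tensor_map[OF assms assms] and m3 = tensor_map[OF assms tensor_map(1)[OF assms assms]]
  show ?thesis
    by (rule tensor_linear_eqI[where t = t],
        rule clinear_compose[OF tensor_insert(1) m3(1)],
        rule clinear_compose[OF m(1) tensor_insert(1)])
       (simp add: tensor_insert m m3)
qed

text \<open>The two hexagon identities read off coefficientwise: at the exponents \<open>(k, -n-1)\<close> their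
  left-hand sides reduce to \<open>S k\<close> applied to a product in the first, respectively second, factor.\<close>

lemma S_Y_left:
  assumes "quantum_va vac Y S"
  shows "S k (Y u n v \<boxtimes> w) = dist2_comp (at_z2 (Yz12 Y))
     (dist2_comp (at_z1 (\<lambda>k. pos23 (S k))) (at_z1_plus_z2 (\<lambda>k. pos13 (S k))))
     k (- n - 1) (u \<boxtimes> v \<boxtimes> w)"
  unfolding quantum_vaD(5)[OF assms, symmetric]
  by (simp add: dist2_comp_at_z1_at_z2 clinear_0[OF quantum_vaD(2)[OF assms]]
      Yz12(2)[OF quantum_vaD(1)[OF assms]])

lemma S_Y_right:
  assumes "quantum_va vac Y S"
  shows "S k (u \<boxtimes> Y v n w) = dist2_comp (at_z2 (Yz23 Y))
     (dist2_comp (at_z1_minus_z2 (\<lambda>k. pos12 (S k))) (at_z1 (\<lambda>k. pos13 (S k))))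
     k (- n - 1) (u \<boxtimes> v \<boxtimes> w)"
  unfolding quantum_vaD(6)[OF assms, symmetric]
  by (simp add: dist2_comp_at_z1_at_z2 clinear_0[OF quantum_vaD(2)[OF assms]]
      Yz23(2)[OF quantum_vaD(1)[OF assms]] Yz(2)[OF quantum_vaD(1)[OF assms]])

text \<open>If \<open>S(z)\<close> maps \<open>u \<otimes> w\<close> and \<open>v \<otimes> G\<close> into \<open>V \<otimes> G\<close>, then it maps \<open>u(n)v \<otimes> w\<close> there as well:
  \<open>S\<^sup>1\<^sup>3\<close> leaves \<open>v\<close> in the middle factor and an element of \<open>G\<close> in the last, so \<open>S\<^sup>2\<^sup>3\<close> only meets
  tensors in \<open>v \<otimes> G\<close>.\<close>

lemma S_Y_left_span:
  assumes qva: "quantum_va vac Y S"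
    and w: "\<And>k. S k (u \<boxtimes> w) \<in> cvec.span {a \<boxtimes> c | a c. c \<in> G}"
    and G: "\<And>k c. c \<in> G \<Longrightarrow> S k (v \<boxtimes> c) \<in> cvec.span {a \<boxtimes> c | a c. c \<in> G}"
  shows "S k (Y u n v \<boxtimes> w) \<in> cvec.span {a \<boxtimes> c | a c. c \<in> G}"
proof -
  note S_lin = quantum_vaD(2)[OF qva] and nva = quantum_vaD(1)[OF qva]
  let ?VG = "cvec.span {a \<boxtimes> c | a c. c \<in> G}"
  let ?W = "{t. \<forall>x. Yz12 Y x t \<in> ?VG}"
  have W: "cvec.subspace ?W"
    by (intro subspace_All subspace_preimage Yz12(1)[OF nva] cvec.subspace_span)
  have W1: "a \<boxtimes> t \<in> ?W" if "t \<in> ?VG" for a t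
    using that
  proof (induction rule: cvec.span_induct)
    case base
    show ?case
      using subspace_preimage[OF pure_tensor_linear(1) W] by simp
  next
    case (step t)
    then obtain b c where t: "t = b \<boxtimes> c" "c \<in> G" by blast
    have "Y a (- x - 1) b \<boxtimes> c \<in> ?VG" for x
      by (rule cvec.span_base) (use t(2) in blast)
    thus ?case by (simp add: t(1) Yz12(2)[OF nva])
  qed
  have W2: "pos23 (S k) (tensor_insert v t) \<in> ?W" if "t \<in> ?VG" for t k
    using that
  proof (induction rule: cvec.span_induct)
    case base
    show ?case
      using subspace_preimage[OF clinear_compose[OF tensor_insert(1) clinear_pos23[OF S_lin]] W] .
  next
    case (step t)
    then obtain a c where "t = a \<boxtimes> c" "c \<in> G" by blast
    thus ?case using W1[OF G] by (simp add: tensor_insert pos23_pure[OF S_lin])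
  qed
  have "dist2_comp (at_z1 (\<lambda>k. pos23 (S k))) (at_z1_plus_z2 (\<lambda>k. pos13 (S k))) x y (u \<boxtimes> v \<boxtimes> w) \<in> ?W"
    for x y
  proof (rule dist2_comp_in_subspace[OF W])
    fix k l
    have *: "pos23 (S i) (c *\<^sub>C t) = c *\<^sub>C pos23 (S i) t" for i c t
      using clinear_pos23[OF S_lin] by (simp add: clinear_iff)
    have "pos23 (S i) (at_z1_plus_z2 (\<lambda>k. pos13 (S k)) k l (u \<boxtimes> v \<boxtimes> w)) \<in> ?W" for i
      using cvec.subspace_scale[OF W W2[OF w]] cvec.subspace_0[OF W]
      by (simp add: at_z1_plus_z2_def pos13_pure[OF S_lin] * clinear_0[OF clinear_pos23[OF S_lin]])
    thus "at_z1 (\<lambda>k. pos23 (S k)) (x - k) (y - l)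
        (at_z1_plus_z2 (\<lambda>k. pos13 (S k)) k l (u \<boxtimes> v \<boxtimes> w)) \<in> ?W"
      using cvec.subspace_0[OF W] by (simp add: at_z1_def)
  qed
  thus ?thesis
    unfolding S_Y_left[OF qva]
    by (intro dist2_comp_in_subspace cvec.subspace_span)
       (auto simp: at_z2_def cvec.span_zero)
qed

text \<open>An injective homomorphism \<open>f\<close> of the underlying nonlocal vertex algebras is now compared
  with the operators \<open>S(z)\<close> of two quantum vertex algebras.\<close>

context
  fixes vac :: "'v::complex_vector" and Y S
    and vac' :: "'w::complex_vector" and Y' S' and f :: "'v \<Rightarrow> 'w"
  assumes qva: "quantum_va vac Y S" and qva': "quantum_va vac' Y' S'"
    and hom: "nonlocal_va_hom UNIV vac Y UNIV vac' Y' f" and inj: "inj f"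
begin

lemma clinear_hom: "clinear f"
  using hom by (simp add: nonlocal_va_hom_def clinear_UNIV)

lemma hom_eqs: "f vac = vac'" "f (Y u n v) = Y' (f u) n (f v)"
  using hom by (simp_all add: nonlocal_va_hom_def)

abbreviation (input) f2 where "f2 \<equiv> tensor_map f f"
abbreviation (input) f3 where "f3 \<equiv> tensor_map f (tensor_map f f)"

lemmas f2 = tensor_map[OF clinear_hom clinear_hom]
lemmas f3 = tensor_map[OF clinear_hom f2(1)]

lemma f2_inj: "f2 t = 0 \<Longrightarrow> t = 0"
  by (rule tensor_map_inj[OF clinear_hom inj clinear_hom inj])

lemma f3_inj: "f3 t = 0 \<Longrightarrow> t = 0"
proof (rule tensor_map_inj[OF clinear_hom inj f2(1)])
  show "inj f2"
  proof (rule injI)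
    fix s t assume "f2 s = f2 t"
    moreover have "f2 (s - t + t) = f2 (s - t) + f2 t" using f2(1) unfolding clinear_iff by blast
    ultimately show "s = t" using f2_inj[of "s - t"] by simp
  qed
qed

lemmas nva = quantum_vaD(1)[OF qva] and nva' = quantum_vaD(1)[OF qva']
lemmas S_lin = quantum_vaD(2)[OF qva] and S'_lin = quantum_vaD(2)[OF qva']

lemma hom_Yz: "f (Yz Y x t) = Yz Y' x (f2 t)"
  by (rule tensor_linear_eqI[OF clinear_compose[OF Yz(1)[OF nva] clinear_hom]
        clinear_compose[OF f2(1) Yz(1)[OF nva']]])
     (simp add: Yz(2)[OF nva] Yz(2)[OF nva'] f2 hom_eqs)

lemma hom_Yz12: "f2 (Yz12 Y x t) = Yz12 Y' x (f3 t)"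
proof (rule tensor_linear_eqI[OF clinear_compose[OF Yz12(1)[OF nva] f2(1)]
      clinear_compose[OF f3(1) Yz12(1)[OF nva']]])
  fix u and t :: "'v tensor2"
  show "f2 (Yz12 Y x (u \<boxtimes> t)) = Yz12 Y' x (f3 (u \<boxtimes> t))"
    by (rule tensor_linear_eqI[where t = t],
        intro clinear_compose[OF _ f2(1)] clinear_compose[OF pure_tensor_linear(1) Yz12(1)[OF nva]],
        intro clinear_compose[OF _ Yz12(1)[OF nva']] clinear_compose[OF pure_tensor_linear(1) f3(1)])
       (simp add: Yz12(2)[OF nva] Yz12(2)[OF nva'] f2 f3 hom_eqs)
qed

lemma hom_Yz23: "f2 (Yz23 Y x t) = Yz23 Y' x (f3 t)"
  by (rule tensor_linear_eqI[OF clinear_compose[OF Yz23(1)[OF nva] f2(1)]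
        clinear_compose[OF f3(1) Yz23(1)[OF nva']]])
     (simp add: Yz23(2)[OF nva] Yz23(2)[OF nva'] f2 f3 hom_Yz)

text \<open>After \<open>S\<^sup>1\<^sup>3\<close> the last factor is no longer \<open>w\<close>, so the intertwining property of \<open>v\<close> is needed
  against everything that may occur there; the span condition confines this to \<open>G\<close>.\<close>

lemma f2_S_Y_left:
  assumes "\<And>k. S k (u \<boxtimes> w) \<in> cvec.span {a \<boxtimes> c | a c. c \<in> G}"
    and "\<And>k. f2 (S k (u \<boxtimes> w)) = S' k (f u \<boxtimes> f w)"
    and "\<And>k c. c \<in> G \<Longrightarrow> f2 (S k (v \<boxtimes> c)) = S' k (f v \<boxtimes> f c)"
  shows "f2 (S k (Y u n v \<boxtimes> w)) = S' k (f (Y u n v) \<boxtimes> f w)"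
proof -
  have s13: "f3 (pos13 (S k) (u \<boxtimes> v \<boxtimes> w)) = pos13 (S' k) (f3 (u \<boxtimes> v \<boxtimes> w))" for k
    by (simp add: pos13_pure[OF S_lin] pos13_pure[OF S'_lin] tensor_map3_insert clinear_hom assms f2 f3)
  have s23: "f3 (pos23 (S k) (pos13 (S j) (u \<boxtimes> v \<boxtimes> w))) =
      pos23 (S' k) (f3 (pos13 (S j) (u \<boxtimes> v \<boxtimes> w)))" for k j
  proof -
    have "f3 (pos23 (S k) (tensor_insert v t)) = pos23 (S' k) (f3 (tensor_insert v t))"
      if "t \<in> cvec.span {a \<boxtimes> c | a c. c \<in> G}" for t
      using that
    proof (induction rule: cvec.span_induct)
      case base
      show ?case
        by (intro subspace_equalizer clinear_compose[OF _ f3(1)]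
            clinear_compose[OF tensor_insert(1) clinear_pos23[OF S_lin]]
            clinear_compose[OF _ clinear_pos23[OF S'_lin]] clinear_compose[OF tensor_insert(1) f3(1)])
    next
      case (step t)
      thus ?case
        by (auto simp: tensor_insert pos23_pure[OF S_lin] pos23_pure[OF S'_lin] f2 f3 assms(3))
    qed
    thus ?thesis using assms(1) by (simp add: pos13_pure[OF S_lin])
  qed
  have scale: "f3 (c *\<^sub>C t) = c *\<^sub>C f3 t" for c t using f3(1) by (simp add: clinear_iff)
  have scale23: "pos23 (S k) (c *\<^sub>C t) = c *\<^sub>C pos23 (S k) t"
    "pos23 (S' k) (c *\<^sub>C t') = c *\<^sub>C pos23 (S' k) t'" for k c t t'
    using clinear_pos23[OF S_lin[of k]] clinear_pos23[OF S'_lin[of k]] by (simp_all add: clinear_iff)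
  note zero = clinear_0[OF f2(1)] clinear_0[OF f3(1)]
    clinear_0[OF clinear_pos23[OF S_lin]] clinear_0[OF clinear_pos23[OF S'_lin]]
  have inner: "f3 (dist2_comp (at_z1 (\<lambda>k. pos23 (S k))) (at_z1_plus_z2 (\<lambda>k. pos13 (S k))) x y (u \<boxtimes> v \<boxtimes> w)) =
      dist2_comp (at_z1 (\<lambda>k. pos23 (S' k))) (at_z1_plus_z2 (\<lambda>k. pos13 (S' k))) x y (f3 (u \<boxtimes> v \<boxtimes> w))"
    for x y
    by (rule dist2_comp_natural[OF f3(1) f3_inj])
       (auto simp: at_z1_def at_z1_plus_z2_def zero scale scale23 s23 s13)
  have "f2 (S k (Y u n v \<boxtimes> w)) = S' k (Y' (f u) n (f v) \<boxtimes> f w)"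
    unfolding S_Y_left[OF qva] S_Y_left[OF qva']
    by (rule dist2_comp_natural[OF f2(1) f2_inj])
       (use inner in \<open>auto simp: at_z2_def zero hom_Yz12 f2 f3\<close>)
  thus ?thesis by (simp add: hom_eqs)
qed

text \<open>In the second factor the intertwining property is assumed against all of \<open>V\<close>, since \<open>S\<^sup>1\<^sup>3\<close> may
  change the first factor arbitrarily.\<close>

lemma f2_S_Y_right:
  assumes "\<And>k u. f2 (S k (u \<boxtimes> v)) = S' k (f u \<boxtimes> f v)"
    and "\<And>k u. f2 (S k (u \<boxtimes> w)) = S' k (f u \<boxtimes> f w)"
  shows "f2 (S k (u \<boxtimes> Y v n w)) = S' k (f u \<boxtimes> f (Y v n w))"
proof -
  have s13: "f3 (pos13 (S k) (u \<boxtimes> v \<boxtimes> w)) = pos13 (S' k) (f3 (u \<boxtimes> v \<boxtimes> w))" for k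
    by (simp add: pos13_pure[OF S_lin] pos13_pure[OF S'_lin] tensor_map3_insert clinear_hom assms f2 f3)
  have "f3 (pos12 (S k) (tensor_insert v t)) = pos12 (S' k) (f3 (tensor_insert v t))" for k t
    by (rule tensor_linear_eqI[where t = t],
        intro clinear_compose[OF _ f3(1)] clinear_compose[OF tensor_insert(1) clinear_pos12[OF S_lin]],
        intro clinear_compose[OF _ clinear_pos12[OF S'_lin]] clinear_compose[OF tensor_insert(1) f3(1)])
       (simp add: tensor_insert pos12_pure[OF S_lin] pos12_pure[OF S'_lin] f2 f3
          tensor_map3_assoc[OF clinear_hom] assms(1))
  hence s12: "f3 (pos12 (S k) (pos13 (S j) (u \<boxtimes> v \<boxtimes> w))) =
      pos12 (S' k) (f3 (pos13 (S j) (u \<boxtimes> v \<boxtimes> w)))" for k j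
    by (simp add: pos13_pure[OF S_lin])
  have scale: "f3 (c *\<^sub>C t) = c *\<^sub>C f3 t" for c t using f3(1) by (simp add: clinear_iff)
  note zero = clinear_0[OF f2(1)] clinear_0[OF f3(1)]
    clinear_0[OF clinear_pos12[OF S_lin]] clinear_0[OF clinear_pos12[OF S'_lin]]
  have inner: "f3 (dist2_comp (at_z1_minus_z2 (\<lambda>k. pos12 (S k))) (at_z1 (\<lambda>k. pos13 (S k))) x y (u \<boxtimes> v \<boxtimes> w)) =
      dist2_comp (at_z1_minus_z2 (\<lambda>k. pos12 (S' k))) (at_z1 (\<lambda>k. pos13 (S' k))) x y (f3 (u \<boxtimes> v \<boxtimes> w))"
    for x y
    by (rule dist2_comp_natural[OF f3(1) f3_inj])
       (auto simp: at_z1_def at_z1_minus_z2_def zero scale s12 s13)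
  have "f2 (S k (u \<boxtimes> Y v n w)) = S' k (f u \<boxtimes> Y' (f v) n (f w))"
    unfolding S_Y_right[OF qva] S_Y_right[OF qva']
    by (rule dist2_comp_natural[OF f2(1) f2_inj])
       (use inner in \<open>auto simp: at_z2_def zero hom_Yz23 f2 f3\<close>)
  thus ?thesis by (simp add: hom_eqs)
qed

text \<open>Intertwining is first extended from generators to all of \<open>V\<close> in the left factor, with the right
  factor still a generator or the vacuum, and then in the right factor.\<close>

lemma quantum_va_homI:
  assumes gen: "va_generated_by UNIV vac Y X"
    and span: "\<And>k u v. u \<in> X \<Longrightarrow> v \<in> X \<Longrightarrow> S k (u \<boxtimes> v) \<in> cvec.span {a \<boxtimes> c | a c. c \<in> insert vac X}"
    and comm: "\<And>k u v. u \<in> X \<Longrightarrow> v \<in> X \<Longrightarrow> f2 (S k (u \<boxtimes> v)) = S' k (f u \<boxtimes> f v)"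
  shows "quantum_va_hom vac Y S vac' Y' S' f"
proof -
  note zero = clinear_0[OF f2(1)] clinear_0[OF f3(1)]
  let ?VX = "cvec.span {a \<boxtimes> c | a c. c \<in> insert vac X}"
  let ?U = "{u. \<forall>g\<in>insert vac X. \<forall>k. S k (u \<boxtimes> g) \<in> ?VX} \<inter>
    {u. \<forall>g\<in>insert vac X. \<forall>k. f2 (S k (u \<boxtimes> g)) = S' k (f u \<boxtimes> f g)}"
  have "UNIV \<subseteq> ?U"
  proof (rule va_generated_by_least[OF gen])
    show "cvec.subspace ?U"
      by (intro cvec.subspace_inter subspace_Ball subspace_All)
         (intro subspace_preimage cvec.subspace_span clinear_compose[OF pure_tensor_linear(2) S_lin],
          intro subspace_equalizer clinear_compose[OF _ f2(1)]
            clinear_compose[OF pure_tensor_linear(2) S_lin] clinear_compose[OF _ S'_lin]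
            clinear_compose[OF clinear_hom pure_tensor_linear(2)])
    show "vac \<in> ?U"
      by (auto simp: quantum_vaD(4)[OF qva] quantum_vaD(4)[OF qva'] hom_eqs f2 zero cvec.span_zero
          intro!: cvec.span_base)
    show "X \<subseteq> ?U"
    proof -
      have "u \<boxtimes> vac \<in> ?VX" for u by (rule cvec.span_base) blast
      thus ?thesis
        using span comm
        by (auto simp: quantum_vaD(3)[OF qva] quantum_vaD(3)[OF qva'] hom_eqs f2 zero cvec.span_zero)
    qed
    show "Y u n v \<in> ?U" if u: "u \<in> ?U" and v: "v \<in> ?U" for u v n
    proof -
      have "S k (Y u n v \<boxtimes> g) \<in> ?VX" if "g \<in> insert vac X" for g k
        by (rule S_Y_left_span[OF qva]) (use u v that in blast)+
      moreover have "f2 (S k (Y u n v \<boxtimes> g)) = S' k (f (Y u n v) \<boxtimes> f g)" if "g \<in> insert vac X" for g k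
        by (rule f2_S_Y_left[where G = "insert vac X"]) (use u v that in blast)+
      ultimately show ?thesis by blast
    qed
  qed
  hence U: "u \<in> ?U" for u by (rule subsetD) simp
  let ?W = "{v. \<forall>k u. f2 (S k (u \<boxtimes> v)) = S' k (f u \<boxtimes> f v)}"
  have "UNIV \<subseteq> ?W"
  proof (rule va_generated_by_least[OF gen])
    show "cvec.subspace ?W"
      by (intro subspace_All subspace_equalizer clinear_compose[OF _ f2(1)]
            clinear_compose[OF pure_tensor_linear(1) S_lin] clinear_compose[OF _ S'_lin]
            clinear_compose[OF clinear_hom pure_tensor_linear(1)])
    have "g \<in> ?W" if g: "g \<in> insert vac X" for g
    proof (intro CollectI allI)
      show "f2 (S k (u \<boxtimes> g)) = S' k (f u \<boxtimes> f g)" for k u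
        using IntD2[OF U[of u]] g by blast
    qed
    thus "vac \<in> ?W" "X \<subseteq> ?W" by blast+
    show "Y u n v \<in> ?W" if "u \<in> ?W" "v \<in> ?W" for u v n
      using f2_S_Y_right[of u v] that by blast
  qed
  hence W: "v \<in> ?W" for v by (rule subsetD) simp
  have "f2 (S k t) = S' k (f2 t)" for k t
    by (rule tensor_linear_eqI[OF clinear_compose[OF S_lin f2(1)] clinear_compose[OF f2(1) S'_lin]])
       (use W in \<open>simp add: f2\<close>)
  thus ?thesis using hom by (simp add: quantum_va_hom_def)
qed

end

section \<open>Translation of the structure constants\<close>

lemma label_cases:
  obtains "b = G0" | c e where "b = lab c e" "c \<in> {L1, L2}"
proof (cases b)
  case (G1 e)
  thus thesis using that(2)[of L1 e] by simp
next
  case (G2 e)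
  thus thesis using that(2)[of L2 e] by simp
qed (use that in simp)

context
  fixes a :: "'i \<Rightarrow> 'i \<Rightarrow> int" and r :: int and d :: "'i \<Rightarrow> int"
    and p :: nat and \<zeta> :: complex and l :: int
  assumes \<zeta>: "\<zeta> \<noteq> 0"
begin

lemma zmod_eq_shift:
  "zmod_eq p (m + s) (n + s) = zmod_eq p m n" "zmod_eq p (m + s + k) (n + s) = zmod_eq p (m + k) n"
  by (simp_all add: zmod_eq_def algebra_simps)

lemma diff_shift: "(n + s) - (m + s) = n - m" "k + (n + s) - (m + s) = k + n - (m :: int)"
  by simp_all

lemma constA_shift: "constA a r d p l b c i j (m + s) (n + s) = constA a r d p l b c i j m n"
  by (cases b; cases c) (simp_all only: constA.simps diff_shift)

lemma constB_shift:
  "constB11 a r d p l e i j (m + s) (n + s) = constB11 a r d p l e i j m n"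
  "constB12 a r d p l i j (m + s) (n + s) = constB12 a r d p l i j m n"
  "constB21 a r d p l i j (m + s) (n + s) = constB21 a r d p l i j m n"
  by (simp_all only: constB11_def constB12_def constB21_def diff_shift)

lemma tau_shift:
  assumes "b \<noteq> L2 \<or> c \<noteq> L2"
  shows "tau a r d p \<zeta> l b c i j (m + s) (n + s) = tau a r d p \<zeta> l b c i j m n"
  using assms by (cases b; cases c) (simp_all only: tau.simps diff_shift, simp_all)

text \<open>The factor \<open>\<zeta>\<^sup>n\<close> makes \<open>\<tau>\<^sup>2\<^sup>,\<^sup>2\<close> the only constant that is not translation invariant.  In all
  relations it enters homogeneously, so the extra scalar \<open>\<zeta>\<^sup>s\<close> cancels.\<close>

lemma tau22_shift:
  "tau a r d p \<zeta> l L2 L2 i j (m + s) (n + s) = fps_const (\<zeta> powi s) * tau a r d p \<zeta> l L2 L2 i j m n"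
  by (simp only: tau.simps diff_shift power_int_add[OF disjI1[OF \<zeta>]])
     (simp add: mult_ac flip: fps_const_mult)

lemma tauL_shift:
  assumes "b \<noteq> L2 \<or> c \<noteq> L2"
  shows "tauL a r d p \<zeta> l b c i j (m + s) (n + s) = tauL a r d p \<zeta> l b c i j m n"
    "tauL_neg a r d p \<zeta> l b c i j (m + s) (n + s) = tauL_neg a r d p \<zeta> l b c i j m n"
  by (simp_all only: tauL_def tauL_neg_def tau_shift[OF assms])

lemma tauL22_shift:
  "tauL a r d p \<zeta> l L2 L2 i j (m + s) (n + s) = fls_const (\<zeta> powi s) * tauL a r d p \<zeta> l L2 L2 i j m n"
  "tauL_neg a r d p \<zeta> l L2 L2 i j (m + s) (n + s) =
     fls_const (\<zeta> powi s) * tauL_neg a r d p \<zeta> l L2 L2 i j m n"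
  by (simp_all add: tauL_def tauL_neg_def tau22_shift fps_compose_mult_distrib
      fls_times_fps_to_fls del: tau.simps)

lemma factor_shift:
  "factor11 a r d p \<zeta> l e i j (m + s) (n + s) = factor11 a r d p \<zeta> l e i j m n"
  "factor12 a r d p \<zeta> l e i j (m + s) (n + s) = factor12 a r d p \<zeta> l e i j m n"
  "factor21 a r d p \<zeta> l e i j (m + s) (n + s) = factor21 a r d p \<zeta> l e i j m n"
  by (simp_all add: factor11_def factor12_def factor21_def constB_shift tauL_shift)

lemma factor22_shift:
  "factor22 a r d p \<zeta> l i j (m + s) (n + s) = fls_const (\<zeta> powi s) * factor22 a r d p \<zeta> l i j m n"
  by (simp add: factor22_def constA_shift tauL22_shift mult_ac)

lemma factor22_ratio_shift:
  "factor22_ratio a r d p \<zeta> l k i j (m + s) (n + s) = factor22_ratio a r d p \<zeta> l k i j m n"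
proof -
  have nz: "fls_const (\<zeta> powi s) \<noteq> 0" using \<zeta> by simp
  thus ?thesis
    by (simp only: factor22_ratio_def constA_shift tauL22_shift mult.left_commute[of _ "fls_const _"]
        mult_divide_mult_cancel_left[OF nz])
qed

text \<open>The contribution of \<open>\<tau>\<close> to the scalar by which \<open>S(z)\<close> acts on two generators with labels \<open>1\<^sup>\<plusminus>\<close>, \<open>2\<^sup>\<plusminus>\<close>.\<close>

lemma exchange_factor_shift:
  "x * tauL_neg a r d p \<zeta> l b c i j (m + s) (n + s) powi (- e) *
     tauL a r d p \<zeta> l c b j i (n + s) (m + s) powi e =
   x * tauL_neg a r d p \<zeta> l b c i j m n powi (- e) * tauL a r d p \<zeta> l c b j i n m powi e"
proof (cases "b = L2 \<and> c = L2")
  case True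
  have "fls_const (\<zeta> powi s) powi (- e) * fls_const (\<zeta> powi s) powi e = 1"
    using \<zeta> by (simp add: power_int_minus)
  thus ?thesis
    using True by (simp add: tauL22_shift power_int_mult_distrib mult_ac)
next
  case False
  thus ?thesis by (auto simp: tauL_shift)
qed

lemma dist2_times_scale:
  assumes "c \<noteq> 0"
  shows "dist2_times (expand12 (fls_const c * F)) G x y = c *\<^sub>C dist2_times (expand12 F) G x y"
    "dist2_times (expand21 (fls_const c * F)) G x y = c *\<^sub>C dist2_times (expand21 F) G x y"
proof -
  have 12: "expand12 (fls_const c * F) = (\<lambda>x y. c * expand12 F x y)"
    by (simp add: expand12_def fun_eq_iff mult_ac)
  have *: "dist2_times (\<lambda>x y. c * C x y) G x y = c *\<^sub>C dist2_times C G x y" for C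
  proof -
    have "c *\<^sub>C dist2_times C G x y =
        Sum_any (\<lambda>kl. c *\<^sub>C (case kl of (k, l) \<Rightarrow> C k l *\<^sub>C G (x - k) (y - l)))"
      unfolding dist2_times_def
      by (rule clinear_inj_Sum_any)
         (use assms in \<open>auto simp: clinear_iff scaleC_add_right scaleC_scaleC mult_ac\<close>)
    also have "\<dots> = dist2_times (\<lambda>x y. c * C x y) G x y"
      unfolding dist2_times_def by (rule Sum_any.cong) (simp add: scaleC_scaleC split: prod.splits)
    finally show ?thesis by simp
  qed
  show "dist2_times (expand12 (fls_const c * F)) G x y = c *\<^sub>C dist2_times (expand12 F) G x y"
    "dist2_times (expand21 (fls_const c * F)) G x y = c *\<^sub>C dist2_times (expand21 F) G x y"
    using *[of "expand12 F"] *[of "expand21 F"] by (simp_all add: 12 expand21_def[abs_def])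
qed

lemma category_M_shift:
  fixes W :: "'w::complex_vector set"
  assumes "category_M a r d p \<zeta> l W X"
  shows "category_M a r d p \<zeta> l W (\<lambda>b i m. X b i (m + s))"
proof -
  note M = assms[unfolded category_M_def]
  note M1 = M[THEN conjunct1] and M = M[THEN conjunct2]
  note M2 = M[THEN conjunct1] and M = M[THEN conjunct2]
  note M3 = M[THEN conjunct1] and M = M[THEN conjunct2]
  note M4 = M[THEN conjunct1] and M = M[THEN conjunct2]
  note M5 = M[THEN conjunct1] and M = M[THEN conjunct2]
  note M6 = M[THEN conjunct1] and M = M[THEN conjunct2]
  note M7 = M[THEN conjunct1] and M = M[THEN conjunct2]
  note M8 = M[THEN conjunct1] and M9 = M[THEN conjunct2]
  show ?thesis
    unfolding category_M_def
  proof (intro conjI allI ballI impI)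
    show "cvec.subspace W" by (rule M1)
    show "field_on W (X b i (m + s))" for b i m using M2 by blast
    show "X b i (m + s) = X b i (n + s)" if "zmod_eq p m n" for b i m n
      using M3 that zmod_eq_shift(1)[of m s n] by blast
  next
    fix i j m n w x y assume "w \<in> W"
    with M4[rule_format, where i = i and j = j and m = "m + s" and n = "n + s" and w = w and x = x and y = y]
    show "field_prod (X G0 i (m + s)) (X G0 j (n + s)) w x y
        - field_prod (X G0 j (n + s)) (X G0 i (m + s)) w y x =
        (expand12 (monomial (constA a r d p l L0 L0 i j m n) (-2) + tauL a r d p \<zeta> l L0 L0 i j m n) x y
          - expand21 (monomial (constA a r d p l L0 L0 j i n m) (-2) + tauL a r d p \<zeta> l L0 L0 j i n m) x y) *\<^sub>C w"
      by (simp only: constA_shift tauL_shift[OF disjI1] level.distinct not_False_eq_True)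
  next
    fix b e i j m n w x y assume b: "b \<in> {L1, L2}" and w: "w \<in> W"
    have n2: "L0 \<noteq> L2 \<or> b \<noteq> L2" "b \<noteq> L2 \<or> L0 \<noteq> L2" by auto
    show "field_prod (X G0 i (m + s)) (X (lab b e) j (n + s)) w x y
        - field_prod (X (lab b e) j (n + s)) (X G0 i (m + s)) w y x =
        of_int (sgn_val e) *\<^sub>C dist2_times
          (\<lambda>x y. expand12 (monomial (constA a r d p l L0 b i j m n) (-1) + tauL a r d p \<zeta> l L0 b i j m n) x y
               + expand21 (monomial (constA a r d p l b L0 j i n m) (-1) + tauL a r d p \<zeta> l b L0 j i n m) x y)
          (\<lambda>x y. if x = 0 then X (lab b e) j (n + s) (- y - 1) w else 0) x y"
      using M5[rule_format, OF b w, where i = i and j = j and m = "m + s" and n = "n + s" and e = e and x = x and y = y]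
      by (simp only: constA_shift tauL_shift[OF n2(1)] tauL_shift[OF n2(2)])
  next
    fix e1 e2 i j m n w x y assume w: "w \<in> W"
    show "let e = sgn_val e1 * sgn_val e2 in
        dist2_times (expand12 (factor11 a r d p \<zeta> l e i j m n))
          (field_prod (X (G1 e1) i (m + s)) (X (G1 e2) j (n + s)) w) x y =
        dist2_times (expand21 (factor11 a r d p \<zeta> l e j i n m))
          (\<lambda>x y. field_prod (X (G1 e2) j (n + s)) (X (G1 e1) i (m + s)) w y x) x y"
      using M6[rule_format, OF w, where i = i and j = j and m = "m + s" and n = "n + s"
          and ?e1.0 = e1 and ?e2.0 = e2 and x = x and y = y]
      by (simp only: factor_shift)
    show "let e = sgn_val e1 * sgn_val e2 in
        dist2_times (expand12 (factor12 a r d p \<zeta> l e i j m n))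
          (field_prod (X (G1 e1) i (m + s)) (X (G2 e2) j (n + s)) w) x y =
        dist2_times (expand21 (factor21 a r d p \<zeta> l e j i n m))
          (\<lambda>x y. field_prod (X (G2 e2) j (n + s)) (X (G1 e1) i (m + s)) w y x) x y"
      using M7[rule_format, OF w, where i = i and j = j and m = "m + s" and n = "n + s"
          and ?e1.0 = e1 and ?e2.0 = e2 and x = x and y = y]
      by (simp only: factor_shift)
  next
    fix e i j m n w x y assume w: "w \<in> W"
    \<comment> \<open>Both sides of the relation at \<open>m + s\<close>, \<open>n + s\<close> carry the same factor \<open>\<zeta>\<^sup>s\<close>.\<close>
    have "\<zeta> powi s \<noteq> 0" using \<zeta> by simp
    thus "dist2_times (expand12 (factor22 a r d p \<zeta> l i j m n))
          (field_prod (X (G2 e) i (m + s)) (X (G2 e) j (n + s)) w) x y =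
        - dist2_times (expand21 (factor22 a r d p \<zeta> l j i n m))
          (\<lambda>x y. field_prod (X (G2 e) j (n + s)) (X (G2 e) i (m + s)) w y x) x y"
      using M8[rule_format, OF w, where i = i and j = j and m = "m + s" and n = "n + s"
          and e = e and x = x and y = y]
      by (simp only: factor22_shift dist2_times_scale cvec.scale_minus_right[symmetric]
          cvec.scale_cancel_left simp_thms)
  next
    fix i j m n w x y assume w: "w \<in> W"
    show "let k = (if i = j \<and> (zmod_eq p m n \<or> zmod_eq p (m + 2 * r * l) n) then 1 else 0 :: nat) in
        (times_diff ^^ k) (field_prod (X (G2 Plus) i (m + s)) (X (G2 Minus) j (n + s)) w) x y =
        - dist2_times (expand21 (factor22_ratio a r d p \<zeta> l k i j m n))
          (\<lambda>x y. field_prod (X (G2 Minus) j (n + s)) (X (G2 Plus) i (m + s)) w y x) x y"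
      using M9[rule_format, OF w, where i = i and j = j and m = "m + s" and n = "n + s"
          and x = x and y = y]
      by (simp only: factor22_ratio_shift zmod_eq_shift)
  qed
qed

section \<open>Translation of the relators and of \<open>S(z)\<close> on generators\<close>

lemma V_relators_hom:
  assumes V: "nonlocal_va V vac Y" and f: "nonlocal_va_hom V vac Y V' vac' Y' f"
    and \<xi>: "\<And>b i m. \<xi> b i m \<in> V" and f\<xi>: "\<And>b i m. f (\<xi> b i m) = \<xi>' b i (m + s)"
    and v: "v \<in> V_relators a r d p \<zeta> l vac Y \<xi>"
  shows "v \<in> V" "f v \<in> V_relators a r d p \<zeta> l vac' Y' \<xi>'"
proof -
  note sV = nonlocal_vaD(1)[OF V] and lin = nonlocal_va_homD(1)[OF f]
  have f_ops: "f (x + y) = f x + f y" "f (x - y) = f x - f y" if "x \<in> V" "y \<in> V" for x y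
    using that lin clinear_on_diff[OF lin sV] by (simp_all add: clinear_on_def)
  have f_scale: "f (c *\<^sub>C x) = c *\<^sub>C f x" if "x \<in> V" for x c
    using that lin by (simp add: clinear_on_def)
  have f0: "f 0 = 0" by (rule clinear_on_0[OF lin sV])
  note mem = \<xi> nonlocal_vaD(2)[OF V] nonlocal_vaD(3)[OF V] cvec.subspace_add[OF sV]
    cvec.subspace_diff[OF sV] cvec.subspace_scale[OF sV] cvec.subspace_0[OF sV]
  note f_simps = f_ops f_scale f0 f\<xi> nonlocal_va_homD(3,4)[OF f] va_derivation_def
  have foldr_Y: "foldr (\<lambda>k. Y (\<xi> b i (g k)) 0) ks x \<in> V \<and>
      f (foldr (\<lambda>k. Y (\<xi> b i (g k)) 0) ks x) = foldr (\<lambda>k. Y' (\<xi>' b i (g k + s)) 0) ks (f x)"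
    if "x \<in> V" for b i g and ks :: "nat list" and x
    using that by (induction ks) (simp_all add: mem nonlocal_va_homD(4)[OF f] f\<xi>)
  have comm: "m + k + s = m + s + k" "m - k + s = m + s - k" for m k :: int by simp_all
  show "v \<in> V" "f v \<in> V_relators a r d p \<zeta> l vac' Y' \<xi>'"
    using v[unfolded V_relators_def]
  proof (atomize (full), elim UnE)
    assume "v \<in> {Y (\<xi> (G2 Plus) i m) 0 (\<xi> (G2 Minus) j n) - (if i = j \<and> zmod_eq p m n then vac else 0)
        + (if i = j \<and> zmod_eq p (m + 2 * r * l) n then \<xi> (G1 Plus) i (m + r * l) else 0)
        |i j m n. True}"
    then obtain i j m n where v: "v = Y (\<xi> (G2 Plus) i m) 0 (\<xi> (G2 Minus) j n)
        - (if i = j \<and> zmod_eq p m n then vac else 0)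
        + (if i = j \<and> zmod_eq p (m + 2 * r * l) n then \<xi> (G1 Plus) i (m + r * l) else 0)" by blast
    have "v \<in> V" by (simp add: v mem)
    moreover have "f v = Y' (\<xi>' (G2 Plus) i (m + s)) 0 (\<xi>' (G2 Minus) j (n + s))
        - (if i = j \<and> zmod_eq p (m + s) (n + s) then vac' else 0)
        + (if i = j \<and> zmod_eq p (m + s + 2 * r * l) (n + s) then \<xi>' (G1 Plus) i (m + s + r * l) else 0)"
      by (simp add: v mem f_simps zmod_eq_shift comm)
    ultimately show "v \<in> V \<and> f v \<in> V_relators a r d p \<zeta> l vac' Y' \<xi>'"
      unfolding V_relators_def by blast
  next
    assume "v \<in> {of_int (sgn_val e) *\<^sub>C
        (Y (\<xi> G0 i (m - d i)) (- 1) (\<xi> (G1 e) i m) - Y (\<xi> G0 i (m + d i)) (- 1) (\<xi> (G1 e) i m))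
        - va_derivation vac Y (\<xi> (G1 e) i m)
        - (tau a r d p \<zeta> l L0 L1 i i (m - d i) m $ 0 - tau a r d p \<zeta> l L0 L1 i i (m + d i) m $ 0) *\<^sub>C
            \<xi> (G1 e) i m
        |e i m. True}"
    then obtain e i m where v: "v = of_int (sgn_val e) *\<^sub>C
        (Y (\<xi> G0 i (m - d i)) (- 1) (\<xi> (G1 e) i m) - Y (\<xi> G0 i (m + d i)) (- 1) (\<xi> (G1 e) i m))
        - va_derivation vac Y (\<xi> (G1 e) i m)
        - (tau a r d p \<zeta> l L0 L1 i i (m - d i) m $ 0 - tau a r d p \<zeta> l L0 L1 i i (m + d i) m $ 0) *\<^sub>C
            \<xi> (G1 e) i m" by blast
    have t: "tau a r d p \<zeta> l L0 L1 i i (m + s - d i) (m + s) = tau a r d p \<zeta> l L0 L1 i i (m - d i) m"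
      "tau a r d p \<zeta> l L0 L1 i i (m + s + d i) (m + s) = tau a r d p \<zeta> l L0 L1 i i (m + d i) m"
      using tau_shift[of L0 L1 i i "m - d i" s m]
        tau_shift[of L0 L1 i i "m + d i" s m]
      by (simp_all only: comm level.distinct not_False_eq_True simp_thms)
    have "v \<in> V" by (simp add: v mem va_derivation_def)
    moreover have "f v = of_int (sgn_val e) *\<^sub>C
        (Y' (\<xi>' G0 i (m + s - d i)) (- 1) (\<xi>' (G1 e) i (m + s))
          - Y' (\<xi>' G0 i (m + s + d i)) (- 1) (\<xi>' (G1 e) i (m + s)))
        - va_derivation vac' Y' (\<xi>' (G1 e) i (m + s))
        - (tau a r d p \<zeta> l L0 L1 i i (m + s - d i) (m + s) $ 0
            - tau a r d p \<zeta> l L0 L1 i i (m + s + d i) (m + s) $ 0) *\<^sub>C \<xi>' (G1 e) i (m + s)"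
      unfolding t by (simp add: v mem f_simps comm del: tau.simps)
    ultimately show "v \<in> V \<and> f v \<in> V_relators a r d p \<zeta> l vac' Y' \<xi>'"
      unfolding V_relators_def by blast
  next
    assume "v \<in> {Y (\<xi> (G1 e) i m) (- 1 - constB11 a r d p l Plus i i m m + constB11 a r d p l Minus i i m m)
          (\<xi> (G1 (opposite e)) i m)
        - ((-1) powi constB11 a r d p l Minus i i m m * (tau a r d p \<zeta> l L1 L2 i i (m + r * l) m $ 0) *
             inverse (tau a r d p \<zeta> l L2 L1 i i m (m + r * l) $ 0)) *\<^sub>C vac
        |e i m. True}"
    then obtain e i m where v: "v = Y (\<xi> (G1 e) i m)
          (- 1 - constB11 a r d p l Plus i i m m + constB11 a r d p l Minus i i m m) (\<xi> (G1 (opposite e)) i m)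
        - ((-1) powi constB11 a r d p l Minus i i m m * (tau a r d p \<zeta> l L1 L2 i i (m + r * l) m $ 0) *
             inverse (tau a r d p \<zeta> l L2 L1 i i m (m + r * l) $ 0)) *\<^sub>C vac" by blast
    have t: "tau a r d p \<zeta> l L1 L2 i i (m + s + r * l) (m + s) = tau a r d p \<zeta> l L1 L2 i i (m + r * l) m"
      "tau a r d p \<zeta> l L2 L1 i i (m + s) (m + s + r * l) = tau a r d p \<zeta> l L2 L1 i i m (m + r * l)"
      using tau_shift[of L1 L2 i i "m + r * l" s m]
        tau_shift[of L2 L1 i i m s "m + r * l"]
      by (simp_all only: comm level.distinct not_False_eq_True simp_thms)
    have "v \<in> V" by (simp add: v mem del: tau.simps)
    moreover have "f v = Y' (\<xi>' (G1 e) i (m + s))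
          (- 1 - constB11 a r d p l Plus i i (m + s) (m + s) + constB11 a r d p l Minus i i (m + s) (m + s))
          (\<xi>' (G1 (opposite e)) i (m + s))
        - ((-1) powi constB11 a r d p l Minus i i (m + s) (m + s) *
             (tau a r d p \<zeta> l L1 L2 i i (m + s + r * l) (m + s) $ 0) *
             inverse (tau a r d p \<zeta> l L2 L1 i i (m + s) (m + s + r * l) $ 0)) *\<^sub>C vac'"
      unfolding t by (simp add: v mem f_simps constB_shift del: tau.simps)
    ultimately show "v \<in> V \<and> f v \<in> V_relators a r d p \<zeta> l vac' Y' \<xi>'"
      unfolding V_relators_def by blast
  next
    assume "v \<in> {foldr (\<lambda>k. Y (\<xi> (G2 e) i (m - d i * a i j - 2 * d i * int k)) 0)
        [0..<nat (1 - a i j)] (\<xi> (G2 e) j m) |e i j m. a i j \<le> 0}"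
    then obtain e i j m where v: "v = foldr (\<lambda>k. Y (\<xi> (G2 e) i (m - d i * a i j - 2 * d i * int k)) 0)
        [0..<nat (1 - a i j)] (\<xi> (G2 e) j m)" and "a i j \<le> 0" by blast
    moreover have "v \<in> V" using foldr_Y[OF \<xi>] by (simp add: v)
    moreover have "f v = foldr (\<lambda>k. Y' (\<xi>' (G2 e) i (m + s - d i * a i j - 2 * d i * int k)) 0)
        [0..<nat (1 - a i j)] (\<xi>' (G2 e) j (m + s))"
      using foldr_Y[OF \<xi>] by (simp add: v f\<xi> comm)
    ultimately show "v \<in> V \<and> f v \<in> V_relators a r d p \<zeta> l vac' Y' \<xi>'"
      unfolding V_relators_def by blast
  next
    assume "v \<in> {foldr (\<lambda>k. Y (\<xi> (G2 e) i (m + 2 * d i * int k)) 0)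
        (rev [1..<p div gcd p (nat (2 * d i))]) (\<xi> (G2 e) i m) |e i m. True}"
    then obtain e i m where v: "v = foldr (\<lambda>k. Y (\<xi> (G2 e) i (m + 2 * d i * int k)) 0)
        (rev [1..<p div gcd p (nat (2 * d i))]) (\<xi> (G2 e) i m)" by blast
    moreover have "v \<in> V" using foldr_Y[OF \<xi>] by (simp add: v)
    moreover have "f v = foldr (\<lambda>k. Y' (\<xi>' (G2 e) i (m + s + 2 * d i * int k)) 0)
        (rev [1..<p div gcd p (nat (2 * d i))]) (\<xi>' (G2 e) i (m + s))"
      using foldr_Y[OF \<xi>] by (simp add: v f\<xi> comm)
    ultimately show "v \<in> V \<and> f v \<in> V_relators a r d p \<zeta> l vac' Y' \<xi>'"
      unfolding V_relators_def by blast
  qed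
qed

lemma S_on_generatorsD:
  assumes "S_on_generators a r d p \<zeta> l vac S \<xi>"
  shows "S k (\<xi> G0 j n \<boxtimes> \<xi> G0 i m) =
        series_tensor (\<xi> G0 j n \<boxtimes> \<xi> G0 i m) 1 k +
        series_tensor (vac \<boxtimes> vac)
          (monomial (constA a r d p l L0 L0 i j m n - constA a r d p l L0 L0 j i n m) (-2)
            + tauL_neg a r d p \<zeta> l L0 L0 i j m n - tauL a r d p \<zeta> l L0 L0 j i n m) k"
    and "b \<in> {L1, L2} \<Longrightarrow> S k (\<xi> G0 j n \<boxtimes> \<xi> (lab b e) i m) =
        series_tensor (\<xi> G0 j n \<boxtimes> \<xi> (lab b e) i m) 1 k +
        of_int (sgn_val e) *\<^sub>C series_tensor (vac \<boxtimes> \<xi> (lab b e) i m)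
          (monomial (constA a r d p l b L0 i j m n - constA a r d p l L0 b j i n m) (-1)
            - tauL_neg a r d p \<zeta> l b L0 i j m n - tauL a r d p \<zeta> l L0 b j i n m) k"
    and "b \<in> {L1, L2} \<Longrightarrow> S k (\<xi> (lab b e) j n \<boxtimes> \<xi> G0 i m) =
        series_tensor (\<xi> (lab b e) j n \<boxtimes> \<xi> G0 i m) 1 k -
        of_int (sgn_val e) *\<^sub>C series_tensor (\<xi> (lab b e) j n \<boxtimes> vac)
          (monomial (constA a r d p l L0 b i j m n - constA a r d p l b L0 j i n m) (-1)
            - tauL_neg a r d p \<zeta> l L0 b i j m n - tauL a r d p \<zeta> l b L0 j i n m) k"
    and "b \<in> {L1, L2} \<Longrightarrow> c \<in> {L1, L2} \<Longrightarrow> S k (\<xi> (lab c e2) j n \<boxtimes> \<xi> (lab b e1) i m) =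
        (if b = L2 \<and> c = L2 then -1 else 1) *\<^sub>C
        series_tensor (\<xi> (lab c e2) j n \<boxtimes> \<xi> (lab b e1) i m)
          ((- fls_X) powi (- (sgn_val e1 * sgn_val e2) * constA a r d p l b c i j m n) *
            fls_X powi (sgn_val e1 * sgn_val e2 * constA a r d p l c b j i n m) *
            tauL_neg a r d p \<zeta> l b c i j m n powi (- (sgn_val e1 * sgn_val e2)) *
            tauL a r d p \<zeta> l c b j i n m powi (sgn_val e1 * sgn_val e2)) k"
  by (rule assms[unfolded S_on_generators_def Let_def, THEN conjunct1, rule_format]
      assms[unfolded S_on_generators_def Let_def, THEN conjunct2, THEN conjunct1, rule_format]
      assms[unfolded S_on_generators_def Let_def, THEN conjunct2, THEN conjunct2, THEN conjunct1, rule_format]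
      assms[unfolded S_on_generators_def Let_def, THEN conjunct2, THEN conjunct2, THEN conjunct2, rule_format];
      assumption)+

lemma S_on_generators_span:
  assumes S: "S_on_generators a r d p \<zeta> l vac S \<xi>"
    and X: "\<And>b i m. \<xi> b i m \<in> X"
  shows "S k (\<xi> c j n \<boxtimes> \<xi> b i m) \<in> cvec.span {u \<boxtimes> v | u v. v \<in> insert vac X}"
proof -
  have base: "u \<boxtimes> vac \<in> cvec.span {u \<boxtimes> v | u v. v \<in> insert vac X}"
    "u \<boxtimes> \<xi> b i m \<in> cvec.span {u \<boxtimes> v | u v. v \<in> insert vac X}" for u b i m
    using X by (blast intro: cvec.span_base)+
  show ?thesis
    by (cases b rule: label_cases; cases c rule: label_cases)
       (simp_all only: S_on_generatorsD[OF S] series_tensor_def cvec.span_add cvec.span_diff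
          cvec.span_scale base)
qed

lemma S_on_generators_shift:
  assumes S: "S_on_generators a r d p \<zeta> l vac S \<xi>" and S': "S_on_generators a r d p \<zeta> l vac' S' \<xi>'"
    and f: "clinear f" "f vac = vac'" "\<And>b i m. f (\<xi> b i m) = \<xi>' b i (m + s)"
  shows "tensor_map f f (S k (\<xi> c j n \<boxtimes> \<xi> b i m)) = S' k (\<xi>' c j (n + s) \<boxtimes> \<xi>' b i (m + s))"
proof -
  note m = tensor_map[OF f(1) f(1)]
  have f2: "tensor_map f f (x + y) = tensor_map f f x + tensor_map f f y"
    "tensor_map f f (q *\<^sub>C x) = q *\<^sub>C tensor_map f f x"
    "tensor_map f f (x - y) = tensor_map f f x - tensor_map f f y" for x y q
    using m(1) clinear_on_diff[of UNIV "tensor_map f f" x y] by (simp_all add: clinear_iff clinear_UNIV)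
  have L02: "L0 \<noteq> L2 \<or> b \<noteq> L2" "b \<noteq> L2 \<or> L0 \<noteq> L2" for b by auto
  show ?thesis
    by (cases b rule: label_cases; cases c rule: label_cases)
       (simp_all only: S_on_generatorsD[OF S] S_on_generatorsD[OF S'] series_tensor_def f2 m f
          constA_shift tauL_shift[OF L02(1)] tauL_shift[OF L02(2)] exchange_factor_shift)
qed

lemma is_VprimeD:
  fixes V U :: "'v::complex_vector set"
  assumes "is_Vprime a r d p \<zeta> l V vac Y \<xi>"
  shows "nonlocal_va V vac Y" "zmod_eq p m n \<Longrightarrow> \<xi> b i m = \<xi> b i n"
    "va_generated_by V vac Y {\<xi> b i m | b i m. True}" "\<xi> b i m \<in> V"
    "category_M a r d p \<zeta> l V (\<lambda>b i m. Y (\<xi> b i m))"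
    "nonlocal_va U vac' Y' \<and> (\<forall>b i m. \<eta> b i m \<in> U) \<and>
      (\<forall>b i m n. zmod_eq p m n \<longrightarrow> \<eta> b i m = \<eta> b i n) \<and>
      category_M a r d p \<zeta> l U (\<lambda>b i m. Y' (\<eta> b i m)) \<Longrightarrow>
      \<exists>f. nonlocal_va_hom V vac Y U vac' Y' f \<and> (\<forall>b i m. f (\<xi> b i m) = \<eta> b i m)"
proof -
  note P = assms[unfolded is_Vprime_def, THEN conjunct2]
  show "nonlocal_va V vac Y" by (rule P[THEN conjunct1])
  note P = P[THEN conjunct2]
  show "zmod_eq p m n \<Longrightarrow> \<xi> b i m = \<xi> b i n" by (rule P[THEN conjunct1, rule_format])
  note P = P[THEN conjunct2]
  show gen: "va_generated_by V vac Y {\<xi> b i m | b i m. True}" by (rule P[THEN conjunct1])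
  show "\<xi> b i m \<in> V"
    using conjunct1[OF gen[unfolded va_generated_by_def]] by blast
  note P = P[THEN conjunct2]
  show "category_M a r d p \<zeta> l V (\<lambda>b i m. Y (\<xi> b i m))" by (rule P[THEN conjunct1])
  note P = P[THEN conjunct2]
  assume "nonlocal_va U vac' Y' \<and> (\<forall>b i m. \<eta> b i m \<in> U) \<and>
      (\<forall>b i m n. zmod_eq p m n \<longrightarrow> \<eta> b i m = \<eta> b i n) \<and>
      category_M a r d p \<zeta> l U (\<lambda>b i m. Y' (\<eta> b i m))"
  from P[THEN spec, THEN spec, THEN spec, THEN spec, THEN mp, OF this]
  show "\<exists>f. nonlocal_va_hom V vac Y U vac' Y' f \<and> (\<forall>b i m. f (\<xi> b i m) = \<eta> b i m)"
    by (elim exE conjE) (intro exI conjI)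
qed

lemma is_VD:
  assumes "is_V a r d p \<zeta> l V' vac' Y' \<xi>' \<pi> vac Y S"
  shows "is_Vprime a r d p \<zeta> l V' vac' Y' \<xi>'"
    "nonlocal_va_hom V' vac' Y' UNIV vac Y \<pi>" "\<pi> ` V' = UNIV"
    "{v \<in> V'. \<pi> v = 0} = va_ideal_generated V' Y' (V_relators a r d p \<zeta> l vac' Y' \<xi>')"
    "quantum_va vac Y S" "S_on_generators a r d p \<zeta> l vac S (\<lambda>b i m. \<pi> (\<xi>' b i m))"
  using assms unfolding is_V_def by simp_all

text \<open>The translated generators satisfy the defining relations of \<open>V'\<close>, so the universal property
  gives an endomorphism of \<open>V'\<close>; it maps relators to relators and hence passes to the quotient \<open>V\<close>.\<close>

lemma is_V_shift:
  fixes V' :: "'v::complex_vector set" and \<pi> :: "'v \<Rightarrow> 'w::complex_vector"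
  assumes "is_V a r d p \<zeta> l V' vac' Y' \<xi>' \<pi> vac Y S"
  shows "\<exists>f. nonlocal_va_hom UNIV vac Y UNIV vac Y f \<and> (\<forall>b i m. f (\<pi> (\<xi>' b i m)) = \<pi> (\<xi>' b i (m + s)))"
proof -
  note V = is_VD[OF assms]
  note V' = is_VprimeD[OF V(1)] and ker = V(4) and W = quantum_vaD(1)[OF V(5)]
  have "nonlocal_va V' vac' Y' \<and> (\<forall>b i m. \<xi>' b i (m + s) \<in> V') \<and>
      (\<forall>b i m n. zmod_eq p m n \<longrightarrow> \<xi>' b i (m + s) = \<xi>' b i (n + s)) \<and>
      category_M a r d p \<zeta> l V' (\<lambda>b i m. Y' (\<xi>' b i (m + s)))"
    by (intro conjI allI impI V' category_M_shift[OF V'(5)]) (simp only: zmod_eq_shift)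
  from V'(6)[OF this] obtain f' where f': "nonlocal_va_hom V' vac' Y' V' vac' Y' f'"
    and "\<forall>b i m. f' (\<xi>' b i m) = \<xi>' b i (m + s)" by (elim exE conjE)
  hence f'\<xi>: "f' (\<xi>' b i m) = \<xi>' b i (m + s)" for b i m by simp
  note rel = V_relators_hom[where \<xi> = \<xi>' and s = s, OF V'(1) f' V'(4) f'\<xi>]
  have "(\<pi> \<circ> f') v = 0" if "v \<in> V'" "\<pi> v = 0" for v
  proof (rule nonlocal_va_hom_zero_on_ideal[OF V'(1) W nonlocal_va_hom_compose[OF f' V(2)]])
    show "V_relators a r d p \<zeta> l vac' Y' \<xi>' \<subseteq> V'" using rel(1) by blast
    show "v \<in> va_ideal_generated V' Y' (V_relators a r d p \<zeta> l vac' Y' \<xi>')"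
      unfolding ker[symmetric] using that by simp
    fix x assume "x \<in> V_relators a r d p \<zeta> l vac' Y' \<xi>'"
    hence "f' x \<in> va_ideal_generated V' Y' (V_relators a r d p \<zeta> l vac' Y' \<xi>')"
      using rel(2)[of x] unfolding va_ideal_generated_def by blast
    thus "(\<pi> \<circ> f') x = 0" unfolding ker[symmetric] by simp
  qed
  from nonlocal_va_hom_descend[OF V'(1) V(2,3) nonlocal_va_hom_compose[OF f' V(2)] this]
  obtain f where f: "nonlocal_va_hom UNIV vac Y UNIV vac Y f" "\<And>v. v \<in> V' \<Longrightarrow> f (\<pi> v) = (\<pi> \<circ> f') v"
    by blast
  have "f (\<pi> (\<xi>' b i m)) = \<pi> (\<xi>' b i (m + s))" for b i m
    by (simp only: f(2)[OF V'(4)] comp_def f'\<xi>)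
  with f(1) show ?thesis by blast
qed

end

theorem proposition4p35:
  fixes br :: "'g::complex_vector \<Rightarrow> 'g \<Rightarrow> 'g" and H :: "'g set"
    and \<alpha> :: "'i::finite \<Rightarrow> 'g \<Rightarrow> complex"
    and a :: "'i \<Rightarrow> 'i \<Rightarrow> int" and r l :: int and d :: "'i \<Rightarrow> int"
    and p :: nat and \<zeta> :: complex
    and V' :: "'v::complex_vector set" and vac' :: 'v and Y' :: "'v \<Rightarrow> 'v modes"
    and \<xi>' :: "label \<Rightarrow> 'i \<Rightarrow> int \<Rightarrow> 'v" and \<pi> :: "'v \<Rightarrow> 'w::complex_vector"
    and vac :: 'w and Y :: "'w \<Rightarrow> 'w modes" and S :: "int \<Rightarrow> 'w tensor2 \<Rightarrow> 'w tensor2"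
    and \<xi> :: "label \<Rightarrow> 'i \<Rightarrow> int \<Rightarrow> 'w"
  assumes "simple_lie_datum br H \<alpha> a"
    and "r = lacing a" and "d = root_weight br H \<alpha> a"
    and "int p > 2 * r"
    and "\<zeta> ^ p = 1" and "\<forall>k\<in>{0<..<p}. \<zeta> ^ k \<noteq> 1"
    and "is_V a r d p \<zeta> l V' vac' Y' \<xi>' \<pi> vac Y S"
    and "\<xi> = (\<lambda>b i m. \<pi> (\<xi>' b i m))"
  shows "\<exists>R.
    (\<forall>s\<in>carrier (integer_mod_group p).
       quantum_va_hom vac Y S vac Y S (R s) \<and>
       (\<forall>b i m. R s (\<xi> b i m) = \<xi> b i (m + s)) \<and>
       (\<forall>f. quantum_va_hom vac Y S vac Y S f \<and> (\<forall>b i m. f (\<xi> b i m) = \<xi> b i (m + s)) \<longrightarrow> f = R s)) \<and>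
    module_quantum_va (integer_mod_group p) vac Y S R"
proof -
  have "1 \<le> lacing a"
  proof -
    have "{- a i j | i j. i \<noteq> j} \<subseteq> (\<lambda>(i, j). - a i j) ` UNIV" by auto
    hence "finite {- a i j | i j. i \<noteq> j}" by (rule finite_subset) simp
    thus ?thesis by (simp add: lacing_def)
  qed
  hence p: "p > 0" using assms(2,4) by linarith
  hence \<zeta>: "\<zeta> \<noteq> 0" using assms(5) by (auto simp: power_0_left)
  have \<xi>: "\<pi> (\<xi>' b i m) = \<xi> b i m" for b i m by (simp add: assms(8))
  note V = is_VD[OF \<zeta> assms(7)]
  note V' = is_VprimeD[OF \<zeta> V(1)] and qva = V(5) and W = quantum_vaD(1)[OF V(5)]
  have S: "S_on_generators a r d p \<zeta> l vac S \<xi>" using V(6) by (simp only: assms(8))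
  define X where "X = {\<xi> b i m | b i m. True}"
  have "\<pi> ` {\<xi>' b i m | b i m. True} = X" unfolding X_def assms(8) by blast
  hence gen: "va_generated_by UNIV vac Y X"
    using va_generated_by_image[OF V'(1) W V'(3) V(2,3)] by simp
  have "\<exists>R. \<forall>s. nonlocal_va_hom UNIV vac Y UNIV vac Y (R s) \<and> (\<forall>b i m. R s (\<xi> b i m) = \<xi> b i (m + s))"
    using is_V_shift[OF \<zeta> assms(7)] unfolding \<xi> by (intro choice allI)
  then obtain R where R: "nonlocal_va_hom UNIV vac Y UNIV vac Y (R s)"
    and R\<xi>: "R s (\<xi> b i m) = \<xi> b i (m + s)" for s b i m by blast
  have unique: "f = g" if "nonlocal_va_hom UNIV vac Y UNIV vac Y f" "nonlocal_va_hom UNIV vac Y UNIV vac Y g"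
    "\<And>b i m. f (\<xi> b i m) = g (\<xi> b i m)" for f g
  proof
    show "f v = g v" for v
      by (rule nonlocal_va_hom_eq_on_generators[OF W W gen that(1,2)]) (use that(3) in \<open>auto simp: X_def\<close>)
  qed
  have R_add: "R s \<circ> R t = R (s + t)" for s t
    by (rule unique[OF nonlocal_va_hom_compose[OF R R] R]) (simp add: R\<xi> algebra_simps)
  have R_0: "R 0 = id"
    by (rule unique[OF R]) (simp_all add: R\<xi> nonlocal_va_hom_def clinear_on_def)
  have R_mod: "R (s mod int p) = R s" for s
  proof (rule unique[OF R R])
    fix b i m
    have "zmod_eq p (m + s mod int p) (m + s)" by (simp add: zmod_eq_def mod_eq_dvd_iff[symmetric])
    hence "\<xi> b i (m + s mod int p) = \<xi> b i (m + s)"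
      unfolding \<xi>[symmetric] by (simp only: V'(2))
    thus "R (s mod int p) (\<xi> b i m) = R s (\<xi> b i m)" by (simp only: R\<xi>)
  qed
  have R_qva: "quantum_va_hom vac Y S vac Y S (R s)" for s
  proof (rule quantum_va_homI[OF qva qva R _ gen])
    have "R (- s) \<circ> R s = id" by (simp add: R_add R_0)
    thus "inj (R s)" by (metis inj_on_id inj_on_imageI2)
    fix k u v assume "u \<in> X" "v \<in> X"
    then obtain c j n b i m where uv: "u = \<xi> c j n" "v = \<xi> b i m" by (auto simp: X_def)
    show "S k (u \<boxtimes> v) \<in> cvec.span {x \<boxtimes> y | x y. y \<in> insert vac X}"
      unfolding uv by (rule S_on_generators_span[OF \<zeta> S]) (auto simp: X_def)
    show "tensor_map (R s) (R s) (S k (u \<boxtimes> v)) = S k (R s u \<boxtimes> R s v)"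
      unfolding uv R\<xi>
      by (rule S_on_generators_shift[OF \<zeta> S S])
         (use nonlocal_va_homD(1,3)[OF R] in \<open>simp_all add: R\<xi> clinear_UNIV\<close>)
  qed
  have "R s \<in> carrier (quantum_va_aut_group vac Y S)" for s
    using R_qva[of s] R_qva[of "- s"] R_add[of s "- s"] R_add[of "- s" s] R_0
    by (auto simp: quantum_va_aut_group_def)
  hence "R \<in> hom (integer_mod_group p) (quantum_va_aut_group vac Y S)"
    by (auto simp: hom_def mult_integer_mod_group R_mod R_add quantum_va_aut_group_def)
  thus ?thesis
    using R_qva R\<xi> qva unique R
    by (intro exI[of _ R]) (auto simp: module_quantum_va_def quantum_va_hom_def)
qed

end
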